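(* Let $\Omega_0,\Omega_1,\Omega_0'$, $\mathbf e=(e_1,e_2,e_3)$, $\varphi$, $f\in C^1(\Omega_0')$, $\beta$, $n_1,n_2$, $\rho_0,\rho_1$ be as in the single-metasurface setup described in the context, and let $$c(x,y)=\sqrt{(\beta-f(\varphi(x)))^2+|\varphi(x)-y|^2},\qquad (x,y)\in\Omega_0\times\Omega_1.$$ Assume that $\Omega_0,\Omega_1$ are compact, $|\partial\Omega_0|=0$, $c$ is $C^1$ and Lipschitz, the map $y\mapsto\nabla_xc(x,y)$ is injective on $\Omega_1$ for each $x\in\Omega_0$, $\int_{\Omega_0}\rho_0\,dx=\int_{\Omega_1}\rho_1\,dx$, and $\rho_0>0$ a.e. in $\Omega_0$. Let $T:\Omega_0\to\Omega_1$ be the optimal map for the Monge problem with cost $c$ from $\rho_0\,dx$ to $\rho_1\,dx$. Then there is a $c$-concave function $\psi:\Omega_0\to\mathbb R$ with $T=\partial_c\psi$ and $\nabla\psi(x)=\nabla_xc(x,Tx)$ for a.e. $x\in\Omega_0$, such that the tangential phase $\Phi$ on $S_1$ for which the metalens $(S_1,\Phi)$ refracts, for a.e. $x\in\Omega_0$, the ray emitted from $(x,0)$ in direction $\mathbf e(x)$ into the point $(Tx,\beta)$ satisfies, for a.e. $x\in\Omega_0$, $$(\Phi_{x_1},\Phi_{x_2})=\left(Id-\frac{\nabla f\otimes\nabla f}{1+|\nabla f|^2}\right)\Big(n_2\,\big(J_\varphi(x)^t\big)^{-1}\nabla\psi(x)+n_1e_3(x)\,\nabla f+n_1\,(e_1(x),e_2(x))\Big),$$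 where $\Phi_{x_1},\Phi_{x_2}$ are evaluated at $(\varphi(x),f(\varphi(x)))$ and $\nabla f$ is evaluated at $\varphi(x)$.
   Context: **Setup (single metasurface).** $\Omega_0,\Omega_1\subset\mathbb R^2$ are planar domains. For each $x=(x_1,x_2)\in\Omega_0$ a unit vector $\mathbf e(x)=(e_1(x),e_2(x),e_3(x))$ with $e_3(x)>0$ is given. $S_1$ is the graph of a function $f$, lying above the plane $z=0$. For each $x\in\Omega_0$ the ray $\{(x,0)+t\,\mathbf e(x):t>0\}$ meets $S_1$ at a unique point $(\varphi(x),f(\varphi(x)))$, where $\varphi:\Omega_0\to\Omega_0'$ is a one-to-one $C^2$ map onto a planar domain $\Omega_0'$ with nonsingular Jacobian matrix $J_\varphi=(\partial\varphi_i/\partial x_j)_{i,j=1}^2$, and $f\in C^1(\Omega_0')$. The plane $z=\beta$ lies at a positive distance above $S_1$. The refractive index is $n_1>0$ between $z=0$ and $S_1$, and $n_2>0$ between $S_1$ and $z=\beta$. $\rho_0,\rho_1$ are nonnegative integrable densities on $\Omega_0,\Omega_1$. **Phase and refraction.** A phase $\Phi$ on $S_1$ is a $C^1$ function defined in a neighborhood of $S_1$ in $\mathbb R^3$, with partial derivatives $\Phi_{x_1},\Phi_{x_2},\Phi_{x_3}$. It is tangential to $S_1$ if $\nabla\Phi(x,f(x))\cdot(-\nabla f(x),1)=0$ for all $x\in\Omega_0'$. The metalens $(S_1,\Phi)$ refracts the ray emitted from $(x,0)$ in direction $\mathbf e(x)$ into the point $(Tx,\beta)$ if the generalized Snell law holds: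 there is $\lambda\in\mathbb R$ with $$n_1\mathbf e(x)-n_2\mathbf m(x)=\lambda\,(-\nabla f(\varphi(x)),1)+\nabla\Phi(\varphi(x),f(\varphi(x))),$$ $$\mathbf m(x)=\frac{(Tx-\varphi(x),\,\beta-f(\varphi(x)))}{\sqrt{|Tx-\varphi(x)|^2+(\beta-f(\varphi(x)))^2}}.$$ **Optimal transport.** A function $\psi:\Omega_0\to\mathbb R$ is $c$-concave if for each $x_0\in\Omega_0$ there exist $m_0\in\Omega_1$, $b\in\mathbb R$ with $\psi(x)\le c(x,m_0)-b$ for all $x\in\Omega_0$, with equality at $x=x_0$. Its $c$-transform is $\psi^c(m)=\inf_{x\in\Omega_0}\{c(x,m)-\psi(x)\}$, and $\partial_c\psi(x)=\{m\in\Omega_1:\psi(x)+\psi^c(m)=c(x,m)\}$; $T=\partial_c\psi$ means $\partial_c\psi(x)=\{Tx\}$ for a.e. $x$. The Monge problem is to minimize $\int_{\Omega_0}c(x,s(x))\rho_0(x)\,dx$ over measurable maps $s$ (defined a.e.) from $\Omega_0$ to $\Omega_1$ with $\int_{s^{-1}(E)}\rho_0\,dx=\int_E\rho_1\,dx$ for every Borel $E\subset\Omega_1$; a minimizer is called an optimal map (unique up to null sets). **Notation.** $u\otimes v=uv^t$ for column vectors; $Id$ is the identity matrix; $|\cdot|$ of a set is Lebesgue measure. *)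

theory Defs
  imports "HOL-Analysis.Analysis"
begin

(* Points of the plane are vectors in real^2, and R^3 is (real^2) \<times> real (with its Euclidean norm and
   inner product), so that (x, z) is the point above x at height z, and the horizontal and vertical
   components of a vector of R^3 are its fst and snd. *)
type_synonym plane = "real ^ 2"
type_synonym space = "(real ^ 2) \<times> real"

(* An open connected set together with any part of its boundary, so that a domain may be compact.
   For an open set D this says that D is nonempty and connected. *)
definition planar_domain :: "plane set \<Rightarrow> bool" where
  "planar_domain D \<longleftrightarrow> (\<exists>U. open U \<and> connected U \<and> U \<noteq> {} \<and> U \<subseteq> D \<and> D \<subseteq> closure U)"

(* g is C^1 on S, with gradient G: g and its gradient, which exists in the interior of S, are
   continuous up to the points of S on its boundary, where G is this continuous extension. For open
   S this is plain continuous differentiability. *)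
definition C1_with_gradient :: "('a::euclidean_space \<Rightarrow> real) \<Rightarrow> ('a \<Rightarrow> 'a) \<Rightarrow> 'a set \<Rightarrow> bool" where
  "C1_with_gradient g G S \<longleftrightarrow>
     continuous_on S g \<and> continuous_on S G \<and> (\<forall>x\<in>interior S. GDERIV g x :> G x)"

(* G is determined by g on S if S lies in the closure of its interior, as planar domains and their
   products do. *)
lemma C1_with_gradient_unique:
  assumes "C1_with_gradient g G S" "C1_with_gradient g G' S" "S \<subseteq> closure (interior S)" "x \<in> S"
  shows "G x = G' x"
proof -
  have inner: "G y - G' y = 0" if "y \<in> interior S" for y
  proof -
    have "(\<lambda>h. inner h (G y)) = (\<lambda>h. inner h (G' y))"
      using assms(1,2) that unfolding C1_with_gradient_def gderiv_def
      by (meson has_derivative_unique)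
    then have "inner (G y - G' y) (G y) = inner (G y - G' y) (G' y)"
      by (rule fun_cong)
    then have "inner (G y - G' y) (G y - G' y) = 0"
      by (simp only: inner_diff_right)
    then show ?thesis
      by simp
  qed
  have cont: "continuous_on S (\<lambda>y. G y - G' y)"
    using assms(1,2) unfolding C1_with_gradient_def by (intro continuous_intros) auto
  have "closedin (top_of_set S) {y \<in> S. G y - G' y = 0}"
    by (rule continuous_closedin_preimage_constant[OF cont])
  then obtain C where C: "closed C" "{y \<in> S. G y - G' y = 0} = S \<inter> C"
    by (auto simp: closedin_closed)
  have "interior S \<subseteq> C"
    using inner interior_subset C(2) by fastforce
  then have "closure (interior S) \<subseteq> C"
    using C(1) by (rule closure_minimal)
  then have "x \<in> S \<inter> C"
    using assms(3,4) by blast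
  then show ?thesis
    using C(2) by auto
qed

(* J x $ i $ j is the partial derivative of the i-th component with respect to x_j. *)
definition C2_with_jacobian :: "(plane \<Rightarrow> plane) \<Rightarrow> (plane \<Rightarrow> real ^ 2 ^ 2) \<Rightarrow> plane set \<Rightarrow> bool" where
  "C2_with_jacobian \<phi> J S \<longleftrightarrow>
     (\<forall>i. C1_with_gradient (\<lambda>x. \<phi> x $ i) (\<lambda>x. J x $ i) S) \<and>
     (\<forall>i j. \<exists>H. C1_with_gradient (\<lambda>x. J x $ i $ j) H S)"

definition tensor :: "real ^ 'n \<Rightarrow> real ^ 'n \<Rightarrow> real ^ 'n ^ 'n" where
  "tensor u v = (\<chi> i j. u $ i * v $ j)"

definition surface :: "plane set \<Rightarrow> (plane \<Rightarrow> real) \<Rightarrow> space set" where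
  "surface \<Omega> f = {(p, f p) | p. p \<in> \<Omega>}"

definition phase :: "space set \<Rightarrow> (space \<Rightarrow> real) \<Rightarrow> (space \<Rightarrow> space) \<Rightarrow> bool" where
  "phase S \<Phi> D\<Phi> \<longleftrightarrow> (\<exists>U. open U \<and> S \<subseteq> U \<and> C1_with_gradient \<Phi> D\<Phi> U)"

definition tangential ::
    "plane set \<Rightarrow> (plane \<Rightarrow> real) \<Rightarrow> (plane \<Rightarrow> plane) \<Rightarrow> (space \<Rightarrow> space) \<Rightarrow> bool" where
  "tangential \<Omega> f Df D\<Phi> \<longleftrightarrow> (\<forall>p\<in>\<Omega>. D\<Phi> (p, f p) \<bullet> (- Df p, 1) = 0)"

(* The generalized Snell law for the incident direction e at the point (p, f p) of the surface and
   the target (y, \<beta>). *)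
definition refracts ::
    "real \<Rightarrow> real \<Rightarrow> real \<Rightarrow> (plane \<Rightarrow> real) \<Rightarrow> (plane \<Rightarrow> plane) \<Rightarrow> (space \<Rightarrow> space)
      \<Rightarrow> space \<Rightarrow> plane \<Rightarrow> plane \<Rightarrow> bool" where
  "refracts n\<^sub>1 n\<^sub>2 \<beta> f Df D\<Phi> e p y \<longleftrightarrow>
     (\<exists>\<mu>. n\<^sub>1 *\<^sub>R e
           - n\<^sub>2 *\<^sub>R ((1 / sqrt ((norm (y - p))\<^sup>2 + (\<beta> - f p)\<^sup>2)) *\<^sub>R (y - p, \<beta> - f p))
         = \<mu> *\<^sub>R (- Df p, 1) + D\<Phi> (p, f p))"

definition c_concave ::
    "('a \<Rightarrow> 'b \<Rightarrow> real) \<Rightarrow> 'a set \<Rightarrow> 'b set \<Rightarrow> ('a \<Rightarrow> real) \<Rightarrow> bool" where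
  "c_concave c \<Omega>\<^sub>0 \<Omega>\<^sub>1 \<psi> \<longleftrightarrow>
     (\<forall>x\<^sub>0\<in>\<Omega>\<^sub>0. \<exists>m\<^sub>0\<in>\<Omega>\<^sub>1. \<exists>b. (\<forall>x\<in>\<Omega>\<^sub>0. \<psi> x \<le> c x m\<^sub>0 - b) \<and> \<psi> x\<^sub>0 = c x\<^sub>0 m\<^sub>0 - b)"

definition c_transform :: "('a \<Rightarrow> 'b \<Rightarrow> real) \<Rightarrow> 'a set \<Rightarrow> ('a \<Rightarrow> real) \<Rightarrow> 'b \<Rightarrow> real" where
  "c_transform c \<Omega>\<^sub>0 \<psi> m = (INF x\<in>\<Omega>\<^sub>0. c x m - \<psi> x)"

definition c_superdiff ::
    "('a \<Rightarrow> 'b \<Rightarrow> real) \<Rightarrow> 'a set \<Rightarrow> 'b set \<Rightarrow> ('a \<Rightarrow> real) \<Rightarrow> 'a \<Rightarrow> 'b set" where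
  "c_superdiff c \<Omega>\<^sub>0 \<Omega>\<^sub>1 \<psi> x = {m\<in>\<Omega>\<^sub>1. \<psi> x + c_transform c \<Omega>\<^sub>0 \<psi> m = c x m}"

(* Maps are total functions. That s need only be defined almost everywhere, with values in the
   target, is the second condition. *)
definition transport_map ::
    "plane set \<Rightarrow> plane set \<Rightarrow> (plane \<Rightarrow> real) \<Rightarrow> (plane \<Rightarrow> real) \<Rightarrow> (plane \<Rightarrow> plane) \<Rightarrow> bool" where
  "transport_map \<Omega>\<^sub>0 \<Omega>\<^sub>1 \<rho>\<^sub>0 \<rho>\<^sub>1 s \<longleftrightarrow>
     s \<in> borel_measurable (lebesgue_on \<Omega>\<^sub>0) \<and>
     (AE x in lebesgue_on \<Omega>\<^sub>0. s x \<in> \<Omega>\<^sub>1) \<and>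
     (\<forall>E\<in>sets borel. E \<subseteq> \<Omega>\<^sub>1 \<longrightarrow>
        (LINT x:{x\<in>\<Omega>\<^sub>0. s x \<in> E}|lebesgue. \<rho>\<^sub>0 x) = (LINT y:E|lebesgue. \<rho>\<^sub>1 y))"

definition optimal_map ::
    "(plane \<Rightarrow> plane \<Rightarrow> real) \<Rightarrow> plane set \<Rightarrow> plane set \<Rightarrow> (plane \<Rightarrow> real) \<Rightarrow> (plane \<Rightarrow> real)
      \<Rightarrow> (plane \<Rightarrow> plane) \<Rightarrow> bool" where
  "optimal_map c \<Omega>\<^sub>0 \<Omega>\<^sub>1 \<rho>\<^sub>0 \<rho>\<^sub>1 T \<longleftrightarrow>
     transport_map \<Omega>\<^sub>0 \<Omega>\<^sub>1 \<rho>\<^sub>0 \<rho>\<^sub>1 T \<and>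
     (\<forall>s. transport_map \<Omega>\<^sub>0 \<Omega>\<^sub>1 \<rho>\<^sub>0 \<rho>\<^sub>1 s \<longrightarrow>
        (LINT x:\<Omega>\<^sub>0|lebesgue. c x (T x) * \<rho>\<^sub>0 x) \<le> (LINT x:\<Omega>\<^sub>0|lebesgue. c x (s x) * \<rho>\<^sub>0 x))"

end

theory Submission
  imports Defs "HOL-Complex_Analysis.Great_Picard"
begin

text \<open>
  The potential comes from Kantorovich duality without transport plans. Maximize
  \<open>\<integral> \<psi> \<rho>\<^sub>0 + \<integral> \<phi> \<rho>\<^sub>1\<close> over continuous \<open>\<phi>\<close> on \<open>\<Omega>\<^sub>1\<close>, where \<open>\<psi> x = min\<^sub>y (c x y - \<phi> y)\<close>; replacing \<open>\<phi>\<close> by its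
  double \<open>c\<close>-transform makes it Lipschitz with the constant of \<open>c\<close>, so Arzela-Ascoli gives a maximizer. At
  an interior point \<open>x\<close> each minimizer \<open>y\<close> yields the supergradient \<open>\<nabla>\<^sub>x c(x, y)\<close> of \<open>\<psi>\<close>. Supergradients of a
  continuous function are unique off a null set, so by the twist condition the minimizer \<open>s x\<close> is unique
  almost everywhere, and there \<open>\<psi>\<close> is differentiable. The first variation of the dual functional shows that
  \<open>s\<close> transports \<open>\<rho>\<^sub>0\<close> to \<open>\<rho>\<^sub>1\<close>; its cost is the dual value, a lower bound for the cost of every transport map.
  Hence the optimal \<open>T\<close> also attains the dual value, and \<open>T = s\<close> almost everywhere.

  For the phase, \<open>n\<^sub>2 J\<^sup>-\<^sup>t \<nabla>\<psi>\<close> is \<open>- n\<^sub>2\<close> times the sum of the horizontal part of \<open>m\<close> and its vertical part times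
  \<open>\<nabla>f\<close>, so Snell's law turns the bracket of the formula into \<open>(Id + \<nabla>f \<otimes> \<nabla>f)\<close> applied to the horizontal
  gradient of a tangential \<open>\<Phi>\<close>, and the projection-like factor in front is the inverse of that matrix.
\<close>

section \<open>Supergradients and push-forwards\<close>

text \<open>For every \<open>n\<close>, \<open>n\<close> translates of \<open>E\<close> along
  \<open>v\<close> are pairwise disjoint and fit into one fixed ball, so \<open>n\<close> times the
  measure of \<open>E\<close> stays bounded.\<close>

lemma negligible_disjoint_translates:
  fixes E :: "'a::euclidean_space set"
  assumes "compact E" "0 < d"
    and disj: "\<And>x t. x \<in> E \<Longrightarrow> 0 < t \<Longrightarrow> t \<le> d \<Longrightarrow> x + t *\<^sub>R v \<notin> E"
  shows "negligible E"
proof -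
  define tr where "tr s = (+) (s *\<^sub>R v) ` E" for s
  have E: "E \<in> lmeasurable"
    using assms(1) by (rule lmeasurable_compact)
  have tr_lmeas: "tr s \<in> lmeasurable" and tr_measure: "measure lebesgue (tr s) = measure lebesgue E" for s
    unfolding tr_def using E by (auto simp: measurable_translation measure_translation)
  have tr_disj: "tr s \<inter> tr t = {}" if "s < t" "t \<le> s + d" for s t
  proof -
    have False if "x \<in> E" "y \<in> E" "s *\<^sub>R v + x = t *\<^sub>R v + y" for x y
    proof -
      have "x = y + (t - s) *\<^sub>R v"
        using that by (simp add: algebra_simps)
      then show False
        using disj[OF that(2), of "t - s"] that(1) \<open>s < t\<close> \<open>t \<le> s + d\<close> by auto
    qed
    then show ?thesis
      unfolding tr_def by auto
  qed
  obtain R where R: "\<And>x. x \<in> E \<Longrightarrow> norm x \<le> R"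
    using compact_imp_bounded[OF assms(1)] unfolding bounded_iff by auto
  define B where "B = cball (0::'a) (R + d * norm v)"
  have trB: "tr s \<subseteq> B" if "0 \<le> s" "s \<le> d" for s
  proof
    fix z assume "z \<in> tr s"
    then obtain x where "x \<in> E" "z = s *\<^sub>R v + x"
      unfolding tr_def by auto
    then have "norm z \<le> s * norm v + R"
      using R norm_triangle_ineq[of "s *\<^sub>R v" x] \<open>0 \<le> s\<close> by fastforce
    also have "\<dots> \<le> d * norm v + R"
      using that by (simp add: mult_right_mono)
    finally show "z \<in> B"
      by (simp add: B_def)
  qed
  have bound: "real n * measure lebesgue E \<le> measure lebesgue B" for n
  proof (cases "n = 0")
    case False
    \<comment> \<open>All shifts lie in \<open>[0, d)\<close>, so any two differ by at most
      \<open>d\<close> and the disjointness hypothesis applies to their difference.\<close>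
    define s where "s i = d * real i / real n" for i :: nat
    have s_range: "0 \<le> s i" "s i \<le> d" if "i < n" for i
      using that assms(2) by (auto simp: s_def field_simps)
    have s_mono: "s i < s j" if "i < j" for i j
      using that assms(2) False by (auto simp: s_def divide_strict_right_mono)
    have disjf: "disjoint_family_on (\<lambda>i. tr (s i)) {..<n}"
      unfolding disjoint_family_on_def
    proof (intro ballI impI)
      fix i j assume ij: "i \<in> {..<n}" "j \<in> {..<n}" "i \<noteq> j"
      show "tr (s i) \<inter> tr (s j) = {}"
      proof (cases "i < j")
        case True
        then show ?thesis using tr_disj[of "s i" "s j"] s_mono s_range[of i] s_range[of j] ij by force
      next
        case False
        then have "j < i" using ij by auto
        then show ?thesis using tr_disj[of "s j" "s i"] s_mono s_range[of i] s_range[of j] ij by force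
      qed
    qed
    have "real n * measure lebesgue E = (\<Sum>i<n. measure lebesgue (tr (s i)))"
      by (simp add: tr_measure)
    also have "\<dots> = measure lebesgue (\<Union>i<n. tr (s i))"
      using disjf fmeasurableD[OF tr_lmeas] fmeasurableD2[OF tr_lmeas]
      by (intro measure_finite_Union[symmetric]) (auto simp only: finite_lessThan image_subset_iff infinity_ennreal_def)
    also have "\<dots> \<le> measure lebesgue B"
    proof (rule measure_mono_fmeasurable)
      show "(\<Union>i<n. tr (s i)) \<subseteq> B" using trB s_range by auto
      show "(\<Union>i<n. tr (s i)) \<in> sets lebesgue" using tr_lmeas by auto
      show "B \<in> lmeasurable" unfolding B_def by simp
    qed
    finally show ?thesis .
  qed simp
  have "measure lebesgue E = 0"
  proof (rule ccontr)
    assume "measure lebesgue E \<noteq> 0"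
    then have "0 < measure lebesgue E"
      using measure_nonneg[of lebesgue E] by linarith
    then obtain n where "measure lebesgue B < real n * measure lebesgue E"
      using reals_Archimedean3 by blast
    then show False
      using bound[of n] by linarith
  qed
  then show ?thesis
    using E by (simp add: negligible_iff_measure0)
qed

text \<open>Membership of \<open>p\<close> in the Frechet superdifferential: the upper half of
  differentiability, with the o(|z - x|) error spelled out by \<open>\<epsilon>\<close>.\<close>

definition supergradient :: "('a::euclidean_space \<Rightarrow> real) \<Rightarrow> 'a \<Rightarrow> 'a \<Rightarrow> bool" where
  "supergradient g x p \<longleftrightarrow>
     (\<forall>\<epsilon>>0. \<forall>\<^sub>F z in nhds x. g z \<le> g x + p \<bullet> (z - x) + \<epsilon> * norm (z - x))"

text \<open>The gap \<open>r - p \<bullet> v\<close> serves as \<open>\<epsilon>\<close>: along the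
  unit vector \<open>v\<close> the error term then just raises the slope from
  \<open>p \<bullet> v\<close> to \<open>r\<close>.\<close>

lemma supergradient_along:
  fixes g :: "'a::euclidean_space \<Rightarrow> real"
  assumes "supergradient g x p" "norm v = 1" "p \<bullet> v < r"
  shows "\<exists>d>0. \<forall>t. 0 \<le> t \<and> t \<le> d \<longrightarrow> g (x + t *\<^sub>R v) \<le> g x + r * t"
proof -
  have "\<forall>\<^sub>F z in nhds x. g z \<le> g x + p \<bullet> (z - x) + (r - p \<bullet> v) * norm (z - x)"
    using assms unfolding supergradient_def by auto
  then obtain e where "e > 0" and
    e: "\<And>z. dist z x < e \<Longrightarrow> g z \<le> g x + p \<bullet> (z - x) + (r - p \<bullet> v) * norm (z - x)"
    unfolding eventually_nhds_metric by auto
  have "g (x + t *\<^sub>R v) \<le> g x + r * t" if "0 \<le> t" "t \<le> e / 2" for t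
    using e[of "x + t *\<^sub>R v"] that \<open>e > 0\<close> assms(2) by (simp add: dist_norm algebra_simps)
  then show ?thesis
    using \<open>e > 0\<close> by (intro exI[of _ "e / 2"]) auto
qed

text \<open>If \<open>p \<bullet> v < r1 < r2 < q \<bullet> v\<close> for two supergradients \<open>p\<close>, \<open>q\<close> at \<open>x\<close>, then near \<open>x\<close> the function lies
  below the line of slope \<open>r1\<close> in direction \<open>v\<close> and below the line of slope \<open>r2\<close> in direction \<open>- v\<close>. Both
  cannot hold on the whole segment between two points \<open>x\<close> and \<open>x + t v\<close>, so the points where they hold on
  a segment of fixed length form a compact set with disjoint small translates. This replaces
  Rademacher's theorem.\<close>

lemma negligible_supergradient_nonunique:
  fixes g :: "'a::euclidean_space \<Rightarrow> real"
  assumes X: "compact X" and g: "continuous_on X g"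
  shows "negligible {x \<in> interior X. \<exists>p q. supergradient g x p \<and> supergradient g x q \<and> p \<noteq> q}"
proof -
  define E where "E v r1 r2 d = {x \<in> X. \<forall>t\<in>{0..d}. x + t *\<^sub>R v \<in> X \<and> x - t *\<^sub>R v \<in> X \<and>
      g (x + t *\<^sub>R v) \<le> g x + r1 * t \<and> g (x - t *\<^sub>R v) \<le> g x - r2 * t}" for v :: 'a and r1 r2 d :: real
  have E_compact: "compact (E v r1 r2 d)" for v r1 r2 d
  proof -
    \<comment> \<open>For fixed \<open>t\<close> the conditions are closed, since \<open>g\<close>
      is continuous on \<open>X\<close> and all three points are kept in \<open>X\<close>;
      intersecting over \<open>t\<close> yields \<open>E\<close>.\<close>
    define F where "F t = {x \<in> X \<inter> (\<lambda>x. x + t *\<^sub>R v) -` X \<inter> (\<lambda>x. x - t *\<^sub>R v) -` X.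
      g (x + t *\<^sub>R v) \<le> g x + r1 * t \<and> g (x - t *\<^sub>R v) \<le> g x - r2 * t}" for t
    have "closed (F t)" for t
    proof -
      let ?S = "X \<inter> (\<lambda>x. x + t *\<^sub>R v) -` X \<inter> (\<lambda>x. x - t *\<^sub>R v) -` X"
      have "closed X" using X compact_imp_closed by blast
      then have cl: "closed ?S"
        by (intro closed_Int closed_vimage continuous_intros) auto
      have c0: "continuous_on ?S g"
        using g by (rule continuous_on_subset) auto
      have c1: "continuous_on ?S (\<lambda>x. g (x + t *\<^sub>R v))"
        by (rule continuous_on_compose2[OF g]) (auto intro!: continuous_intros)
      have c2: "continuous_on ?S (\<lambda>x. g (x - t *\<^sub>R v))"
        by (rule continuous_on_compose2[OF g]) (auto intro!: continuous_intros)
      have "F t = {x \<in> ?S. g (x + t *\<^sub>R v) \<le> g x + r1 * t} \<inter> {x \<in> ?S. g (x - t *\<^sub>R v) \<le> g x - r2 * t}"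
        by (auto simp: F_def)
      moreover have "closed {x \<in> ?S. g (x + t *\<^sub>R v) \<le> g x + r1 * t}"
        by (intro continuous_on_closed_Collect_le c0 c1 cl continuous_intros)
      moreover have "closed {x \<in> ?S. g (x - t *\<^sub>R v) \<le> g x - r2 * t}"
        by (intro continuous_on_closed_Collect_le c0 c2 cl continuous_intros)
      ultimately show ?thesis
        by auto
    qed
    moreover have "E v r1 r2 d = X \<inter> (\<Inter>t\<in>{0..d}. F t)"
      by (auto simp: E_def F_def)
    ultimately show ?thesis
      using X by (auto intro!: compact_Int_closed closed_INT)
  qed
  have E_negligible: "negligible (E v r1 r2 d)" if "r1 < r2" "0 < d" for v r1 r2 d
  proof (rule negligible_disjoint_translates[OF E_compact \<open>0 < d\<close>, where v = v])
    fix x t assume "x \<in> E v r1 r2 d" "0 < t" "t \<le> d"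
    show "x + t *\<^sub>R v \<notin> E v r1 r2 d"
    proof
      assume "x + t *\<^sub>R v \<in> E v r1 r2 d"
      then have "g (x + t *\<^sub>R v - t *\<^sub>R v) \<le> g (x + t *\<^sub>R v) - r2 * t"
        unfolding E_def using \<open>0 < t\<close> \<open>t \<le> d\<close> by (elim CollectE conjE) (metis atLeastAtMost_iff less_imp_le)
      moreover have "g (x + t *\<^sub>R v) \<le> g x + r1 * t"
        using \<open>x \<in> E v r1 r2 d\<close> \<open>0 < t\<close> \<open>t \<le> d\<close> unfolding E_def by auto
      ultimately have "r2 * t \<le> r1 * t"
        by simp
      then show False
        using that \<open>0 < t\<close> by simp
    qed
  qed
  \<comment> \<open>Rational slopes and lengths \<open>1 / Suc n\<close> leave countably many sets
    \<open>E\<close>.\<close>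
  define I where "I = {(v, r1, r2, n). (v::'a) \<in> Basis \<and> r1 \<in> \<rat> \<and> r2 \<in> \<rat> \<and> r1 < (r2::real) \<and> (n::nat) \<in> UNIV}"
  have "countable (Basis \<times> \<rat> \<times> \<rat> \<times> (UNIV::nat set) :: ('a \<times> real \<times> real \<times> nat) set)"
    by (intro countable_SIGMA countable_rat) (auto intro: countable_finite)
  then have "countable I"
    by (rule countable_subset[rotated]) (auto simp: I_def)
  have "negligible (\<Union>i\<in>I. case i of (v, r1, r2, n) \<Rightarrow> E v r1 r2 (1 / Suc n))" (is "negligible ?U")
    using \<open>countable I\<close> E_negligible
    by (intro negligible_countable_Union countable_image) (auto simp: I_def)
  moreover have "{x \<in> interior X. \<exists>p q. supergradient g x p \<and> supergradient g x q \<and> p \<noteq> q} \<subseteq> ?U"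
  proof clarify
    fix x p0 q0 assume x: "x \<in> interior X" and sg0: "supergradient g x p0" "supergradient g x q0" "p0 \<noteq> q0"
    obtain v where v: "v \<in> Basis" "p0 \<bullet> v \<noteq> q0 \<bullet> v"
      using sg0(3) by (auto simp: euclidean_eq_iff[of p0 q0])
    \<comment> \<open>The two supergradients are swapped if necessary, so that \<open>p\<close> has
      the smaller slope along \<open>v\<close>.\<close>
    obtain p q where sg: "supergradient g x p" "supergradient g x q" "p \<bullet> v < q \<bullet> v"
      using sg0 v by (metis linorder_neqE_linordered_idom)
    obtain r1 where r1: "r1 \<in> \<rat>" "p \<bullet> v < r1" "r1 < q \<bullet> v"
      using Rats_dense_in_real[OF sg(3)] by auto
    obtain r2 where r2: "r2 \<in> \<rat>" "r1 < r2" "r2 < q \<bullet> v"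
      using Rats_dense_in_real[OF r1(3)] by auto
    obtain d1 where d1: "d1 > 0" "\<And>t. 0 \<le> t \<Longrightarrow> t \<le> d1 \<Longrightarrow> g (x + t *\<^sub>R v) \<le> g x + r1 * t"
      using supergradient_along[OF sg(1) _ r1(2)] v(1) by auto
    \<comment> \<open>Along \<open>- v\<close> the slope of \<open>q\<close> is
      \<open>- (q \<bullet> v)\<close>, which lies below \<open>- r2\<close>.\<close>
    obtain d2 where d2: "d2 > 0" "\<And>t. 0 \<le> t \<Longrightarrow> t \<le> d2 \<Longrightarrow> g (x + t *\<^sub>R (- v)) \<le> g x + (- r2) * t"
      using supergradient_along[OF sg(2), of "- v" "- r2"] v(1) r2(3) by auto
    obtain d3 where d3: "d3 > 0" "cball x d3 \<subseteq> X"
      using x mem_interior_cball by blast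
    obtain n :: nat where n: "1 / Suc n < min d1 (min d2 d3)"
      using d1(1) d2(1) d3(1) nat_approx_posE[of "min d1 (min d2 d3)"] by auto
    have "x \<in> E v r1 r2 (1 / Suc n)"
      unfolding E_def
    proof (intro CollectI conjI ballI)
      show "x \<in> X" using x interior_subset by auto
      fix t assume t: "t \<in> {0..1 / real (Suc n)}"
      then have tle: "0 \<le> t" "t \<le> d1" "t \<le> d2" "t \<le> d3"
        using n by auto
      then have "dist x (x + t *\<^sub>R v) \<le> d3" "dist x (x - t *\<^sub>R v) \<le> d3"
        using v(1) by (auto simp: dist_norm)
      then show "x + t *\<^sub>R v \<in> X" "x - t *\<^sub>R v \<in> X"
        using d3(2) by auto
      show "g (x + t *\<^sub>R v) \<le> g x + r1 * t" "g (x - t *\<^sub>R v) \<le> g x - r2 * t"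
        using d1(2)[of t] d2(2)[of t] tle by auto
    qed
    then show "x \<in> ?U"
      using v(1) r1(1) r2(1,2) by (auto simp: I_def intro!: bexI[of _ "(v, r1, r2, n)"])
  qed
  ultimately show ?thesis
    using negligible_subset by blast
qed

section \<open>Measures determined by integrals of continuous functions\<close>

text \<open>Closed sets form an intersection-stable generator of the Borel sets, and their
  indicators are pointwise limits of continuous functions with values in [0, 1].\<close>

lemma finite_measure_eqI_continuous:
  fixes P Q :: "'a::metric_space measure"
  assumes P: "finite_measure P" "sets P = sets borel" and Q: "finite_measure Q" "sets Q = sets borel"
    and eq: "\<And>h :: 'a \<Rightarrow> real. continuous_on UNIV h \<Longrightarrow> (\<forall>x. 0 \<le> h x \<and> h x \<le> 1) \<Longrightarrow> integral\<^sup>L P h = integral\<^sup>L Q h"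
  shows "P = Q"
proof -
  have space: "space P = UNIV" "space Q = UNIV"
    using sets_eq_imp_space_eq[OF P(2)] sets_eq_imp_space_eq[OF Q(2)] by simp_all
  have closed_eq: "measure P C = measure Q C" if "closed C" for C
  \<comment> \<open>\<open>infdist\<close> to the empty set is 0 by convention, so the functions
    \<open>h n\<close> below would not tend to its indicator.\<close>
  proof (cases "C = {}")
    case False
    define h where "h n x = max 0 (1 - real n * infdist x C)" for n :: nat and x
    have h_cont: "continuous_on UNIV (h n)" for n
      unfolding h_def by (intro continuous_intros)
    have h_bound: "0 \<le> h n x \<and> h n x \<le> 1" for n x
      unfolding h_def using infdist_nonneg[of x C] by auto
    have h_lim: "(\<lambda>n. h n x) \<longlonglongrightarrow> indicator C x" for x
    proof (cases "x \<in> C")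
      case True
      then show ?thesis by (simp add: h_def)
    next
      case x: False
      then have pos: "infdist x C > 0"
        using in_closed_iff_infdist_zero[OF that False] infdist_nonneg[of x C] by force
      obtain m :: nat where m: "1 < real m * infdist x C"
        using reals_Archimedean3[OF pos] by blast
      have "h n x = 0" if "n \<ge> m" for n
      proof -
        have "real m * infdist x C \<le> real n * infdist x C"
          using that pos by simp
        then show ?thesis using m by (simp add: h_def)
      qed
      then have "\<forall>\<^sub>F n in sequentially. h n x = 0"
        unfolding eventually_sequentially by blast
      then show ?thesis
        using x by (simp add: tendsto_eventually)
    qed
    have lim: "(\<lambda>n. integral\<^sup>L R (h n)) \<longlonglongrightarrow> measure R C"
      if R: "finite_measure R" "sets R = sets borel" for R
    proof -
      interpret finite_measure R by fact
      have meas: "borel_measurable R = borel_measurable borel"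
        using R(2) by (rule measurable_cong_sets) simp
      have "(\<lambda>n. integral\<^sup>L R (h n)) \<longlonglongrightarrow> integral\<^sup>L R (indicator C)"
      proof (rule integral_dominated_convergence[where w = "\<lambda>_. 1"])
        show "indicator C \<in> borel_measurable R" "\<And>n. h n \<in> borel_measurable R"
          using \<open>closed C\<close> h_cont unfolding meas by (auto intro: borel_measurable_continuous_onI)
        show "AE x in R. (\<lambda>n. h n x) \<longlonglongrightarrow> indicator C x"
          using h_lim by simp
        show "AE x in R. norm (h n x) \<le> 1" for n
          using h_bound by simp
      qed simp
      then show ?thesis
        using \<open>closed C\<close> sets_eq_imp_space_eq[OF R(2)] R(2) by simp
    qed
    have "(\<lambda>n. integral\<^sup>L P (h n)) = (\<lambda>n. integral\<^sup>L Q (h n))"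
      using eq[OF h_cont] h_bound by blast
    then show ?thesis
      using lim[OF P] lim[OF Q] LIMSEQ_unique by metis
  qed simp
  show ?thesis
  proof (rule measure_eqI_generator_eq[where \<Omega> = UNIV and E = "Collect closed" and A = "\<lambda>_. UNIV"])
    show "Int_stable (Collect closed)"
      by (auto simp: Int_stable_def)
    show "emeasure P C = emeasure Q C" if "C \<in> Collect closed" for C
      using that closed_eq[of C] by (simp add: finite_measure.emeasure_eq_measure P(1) Q(1))
    show "sets P = sigma_sets UNIV (Collect closed)" "sets Q = sigma_sets UNIV (Collect closed)"
      by (simp_all add: P(2) Q(2) borel_eq_closed)
    show "emeasure P UNIV \<noteq> \<infinity>"
      using finite_measure.emeasure_finite[OF P(1)] by simp
  qed auto
qed

section \<open>c-transforms on compact sets\<close>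

text \<open>Outside the ball the compact remainder of \<open>Y\<close> has a minimum strictly above
  \<open>F l\<close>; half of that gap is a suitable \<open>\<eta>\<close>.\<close>

lemma near_minimizer_close:
  fixes F :: "'a::metric_space \<Rightarrow> real"
  assumes Y: "compact Y" and F: "continuous_on Y F"
    and unique: "\<And>y. y \<in> Y \<Longrightarrow> y \<noteq> l \<Longrightarrow> F l < F y" and "0 < \<epsilon>"
  shows "\<exists>\<eta>>0. \<forall>y\<in>Y. F y \<le> F l + \<eta> \<longrightarrow> dist y l < \<epsilon>"
proof (cases "Y - ball l \<epsilon> = {}")
  case True
  then show ?thesis
    by (intro exI[of _ 1]) (auto simp: dist_commute)
next
  case False
  have "compact (Y - ball l \<epsilon>)"
    using Y by (simp add: compact_diff)
  moreover have "continuous_on (Y - ball l \<epsilon>) F"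
    using F by (rule continuous_on_subset) auto
  ultimately obtain z where z: "z \<in> Y - ball l \<epsilon>" "\<And>y. y \<in> Y - ball l \<epsilon> \<Longrightarrow> F z \<le> F y"
    using continuous_attains_inf[OF _ False] by blast
  then have "F l < F z"
    using unique[of z] \<open>0 < \<epsilon>\<close> by (cases "z = l") auto
  show ?thesis
  proof (intro exI[of _ "(F z - F l) / 2"] conjI ballI impI)
    show "0 < (F z - F l) / 2" using \<open>F l < F z\<close> by simp
    fix y assume "y \<in> Y" "F y \<le> F l + (F z - F l) / 2"
    then have "\<not> F z \<le> F y" using \<open>F l < F z\<close> by (simp add: field_simps)
    then show "dist y l < \<epsilon>" using z(2)[of y] \<open>y \<in> Y\<close> by (auto simp: dist_commute)
  qed
qed

lemma c_transform_attained:
  fixes c :: "'a::topological_space \<Rightarrow> 'b \<Rightarrow> real"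
  assumes "compact X" "X \<noteq> {}" "continuous_on X (\<lambda>x. c x m)" "continuous_on X \<psi>"
  obtains x where "x \<in> X" "c_transform c X \<psi> m = c x m - \<psi> x"
    "\<And>x'. x' \<in> X \<Longrightarrow> c_transform c X \<psi> m \<le> c x' m - \<psi> x'"
proof -
  have "continuous_on X (\<lambda>x. c x m - \<psi> x)"
    using assms by (intro continuous_intros)
  then obtain x where x: "x \<in> X" "\<And>x'. x' \<in> X \<Longrightarrow> c x m - \<psi> x \<le> c x' m - \<psi> x'"
    using continuous_attains_inf[OF assms(1,2)] by blast
  then have "c_transform c X \<psi> m = c x m - \<psi> x"
    unfolding c_transform_def by (intro cInf_eq_minimum) auto
  with x show ?thesis
    using that by simp
qed

text \<open>One joint Lipschitz constant is fixed as a parameter because the transforms of all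
  continuous functions inherit it.\<close>

locale compact_cost =
  fixes c :: "'a::euclidean_space \<Rightarrow> 'b::euclidean_space \<Rightarrow> real" and X :: "'a set" and Y :: "'b set" and L :: real
  assumes compact_X: "compact X" and X_nonempty: "X \<noteq> {}"
    and compact_Y: "compact Y" and Y_nonempty: "Y \<noteq> {}"
    and c_lipschitz: "L-lipschitz_on (X \<times> Y) (\<lambda>(x, y). c x y)"
begin

text \<open>The hypotheses are symmetric in the two arguments, so every fact about \<open>cX\<close>
  carries over to \<open>cY\<close>.\<close>

lemma swap: "compact_cost (\<lambda>y x. c x y) Y X L"
proof
  show "L-lipschitz_on (Y \<times> X) (\<lambda>(y, x). c x y)"
  proof (rule lipschitz_onI)
    fix p q assume "p \<in> Y \<times> X" "q \<in> Y \<times> X"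
    then have "dist (case prod.swap p of (x, y) \<Rightarrow> c x y) (case prod.swap q of (x, y) \<Rightarrow> c x y)
        \<le> L * dist (prod.swap p) (prod.swap q)"
      by (intro lipschitz_onD[OF c_lipschitz]) auto
    then show "dist (case p of (y, x) \<Rightarrow> c x y) (case q of (y, x) \<Rightarrow> c x y) \<le> L * dist p q"
      by (simp add: case_prod_beta dist_prod_def add.commute)
  qed (rule lipschitz_on_nonneg[OF c_lipschitz])
qed (use compact_X X_nonempty compact_Y Y_nonempty in auto)

lemma c_continuous: "continuous_on (X \<times> Y) (\<lambda>(x, y). c x y)"
  using c_lipschitz by (rule lipschitz_on_continuous_on)

lemma c_dist_fst: "\<bar>c x y - c x' y\<bar> \<le> L * dist x x'" if "x \<in> X" "x' \<in> X" "y \<in> Y"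
  using lipschitz_onD[OF c_lipschitz, of "(x, y)" "(x', y)"] that
  by (simp add: dist_real_def dist_Pair_Pair)

lemma c_dist_snd: "\<bar>c x y - c x y'\<bar> \<le> L * dist y y'" if "x \<in> X" "y \<in> Y" "y' \<in> Y"
  using lipschitz_onD[OF c_lipschitz, of "(x, y)" "(x, y')"] that
  by (simp add: dist_real_def dist_Pair_Pair)

lemma c_continuous_fst: "continuous_on X (\<lambda>x. c x y)" if "y \<in> Y"
proof -
  have "continuous_on X (\<lambda>x. (x, y))" "(\<lambda>x. (x, y)) ` X \<subseteq> X \<times> Y"
    using that by (auto intro!: continuous_intros)
  from continuous_on_compose2[OF c_continuous this] show ?thesis
    by simp
qed

abbreviation cX :: "('a \<Rightarrow> real) \<Rightarrow> 'b \<Rightarrow> real" where "cX \<equiv> c_transform c X"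
abbreviation cY :: "('b \<Rightarrow> real) \<Rightarrow> 'a \<Rightarrow> real" where "cY \<equiv> c_transform (\<lambda>y x. c x y) Y"

lemma cX_attained:
  assumes "continuous_on X \<psi>" "y \<in> Y"
  obtains x where "x \<in> X" "cX \<psi> y = c x y - \<psi> x"
  by (rule c_transform_attained[where c = c, OF compact_X X_nonempty c_continuous_fst[OF assms(2)] assms(1)])

lemma cX_le:
  assumes "continuous_on X \<psi>" "y \<in> Y" "x \<in> X"
  shows "cX \<psi> y \<le> c x y - \<psi> x"
  by (rule c_transform_attained[where c = c, OF compact_X X_nonempty c_continuous_fst[OF assms(2)] assms(1)])
    (use assms(3) in blast)

text \<open>A minimizer for \<open>y'\<close> competes at \<open>y\<close>, and only the cost
  changes; hence the constant is independent of \<open>\<psi>\<close>.\<close>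

lemma cX_lipschitz:
  assumes "continuous_on X \<psi>"
  shows "L-lipschitz_on Y (cX \<psi>)"
proof (rule lipschitz_onI)
  have *: "cX \<psi> y - cX \<psi> y' \<le> L * dist y y'" if "y \<in> Y" "y' \<in> Y" for y y'
  proof -
    obtain x where x: "x \<in> X" "cX \<psi> y' = c x y' - \<psi> x"
      by (rule cX_attained[OF assms \<open>y' \<in> Y\<close>])
    then show ?thesis
      using cX_le[OF assms \<open>y \<in> Y\<close> x(1)] c_dist_snd[OF x(1) that] by linarith
  qed
  show "dist (cX \<psi> y) (cX \<psi> y') \<le> L * dist y y'" if "y \<in> Y" "y' \<in> Y" for y y'
    using *[OF that] *[OF that(2,1)] by (simp add: dist_real_def dist_commute abs_le_iff)
qed (rule lipschitz_on_nonneg[OF c_lipschitz])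

lemma cX_continuous: "continuous_on X \<psi> \<Longrightarrow> continuous_on Y (cX \<psi>)"
  using cX_lipschitz lipschitz_on_continuous_on by blast

text \<open>A minimizer for \<open>\<psi>'\<close> competes for \<open>\<psi>\<close>. With
  \<open>d = 0\<close> this is order reversal, with \<open>d\<close> the uniform distance it is
  nonexpansiveness.\<close>

lemma cX_diff_le:
  assumes "continuous_on X \<psi>" "continuous_on X \<psi>'" "y \<in> Y" "\<And>x. x \<in> X \<Longrightarrow> \<psi>' x - \<psi> x \<le> d"
  shows "cX \<psi> y - cX \<psi>' y \<le> d"
proof -
  obtain x where x: "x \<in> X" "cX \<psi>' y = c x y - \<psi>' x"
    using cX_attained[OF assms(2,3)] .
  then show ?thesis
    using cX_le[OF assms(1,3) x(1)] assms(4)[OF x(1)] by linarith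
qed

lemma cX_cong: "cX \<psi> = cX \<psi>'" if "\<And>x. x \<in> X \<Longrightarrow> \<psi> x = \<psi>' x"
  unfolding c_transform_def using that by (intro ext INF_cong) auto

lemmas cY_attained = compact_cost.cX_attained[OF swap]
  and cY_le = compact_cost.cX_le[OF swap]
  and cY_lipschitz = compact_cost.cX_lipschitz[OF swap]
  and cY_continuous = compact_cost.cX_continuous[OF swap]
  and cY_diff_le = compact_cost.cX_diff_le[OF swap]
  and c_continuous_snd = compact_cost.c_continuous_fst[OF swap]

lemma le_cX_cY:
  assumes "continuous_on Y \<phi>" "y \<in> Y"
  shows "\<phi> y \<le> cX (cY \<phi>) y"
proof -
  obtain x where x: "x \<in> X" "cX (cY \<phi>) y = c x y - cY \<phi> x"
    using cX_attained[OF cY_continuous[OF assms(1)] assms(2)] .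
  then show ?thesis
    using cY_le[OF assms(1) x(1) assms(2)] by linarith
qed

text \<open>Order reversal applied to \<open>\<phi> \<le> cX (cY \<phi>)\<close> gives one
  inequality; the other is the constraint \<open>cX (cY \<phi>) y \<le> c x y - cY \<phi> x\<close>
  at a minimizer \<open>y\<close>.\<close>

lemma cY_cX_cY:
  assumes "continuous_on Y \<phi>" "x \<in> X"
  shows "cY (cX (cY \<phi>)) x = cY \<phi> x"
proof (rule antisym)
  have cont: "continuous_on X (cY \<phi>)" "continuous_on Y (cX (cY \<phi>))"
    using assms(1) cY_continuous cX_continuous by blast+
  show "cY (cX (cY \<phi>)) x \<le> cY \<phi> x"
    using cY_diff_le[OF cont(2) assms(1) assms(2), of 0] le_cX_cY[OF assms(1)] by simp
  obtain y where y: "y \<in> Y" "cY (cX (cY \<phi>)) x = c x y - cX (cY \<phi>) y"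
    using cY_attained[OF cont(2) assms(2)] .
  then show "cY \<phi> x \<le> cY (cX (cY \<phi>)) x"
    using cX_le[OF cont(1) y(1) assms(2)] by linarith
qed

section \<open>Minimizers and their stability\<close>

text \<open>When \<open>cX (cY \<phi>) = \<phi>\<close>, this set is the c-superdifferential of
  \<open>cY \<phi>\<close> at \<open>x\<close>.\<close>

definition minimizers :: "('b \<Rightarrow> real) \<Rightarrow> 'a \<Rightarrow> 'b set" where
  "minimizers \<phi> x = {y \<in> Y. cY \<phi> x = c x y - \<phi> y}"

lemma minimizers_nonempty:
  assumes "continuous_on Y \<phi>" "x \<in> X"
  shows "minimizers \<phi> x \<noteq> {}"
proof -
  obtain y where "y \<in> Y" "cY \<phi> x = c x y - \<phi> y"
    by (rule cY_attained[OF assms])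
  then show ?thesis
    unfolding minimizers_def by auto
qed

lemma unique_minimizer_close:
  assumes \<phi>: "continuous_on Y \<phi>" and x: "x \<in> X" "minimizers \<phi> x = {l}" and "0 < \<epsilon>"
  shows "\<exists>\<eta>>0. \<forall>y\<in>Y. c x y - \<phi> y \<le> cY \<phi> x + \<eta> \<longrightarrow> dist y l < \<epsilon>"
proof -
  have "l \<in> minimizers \<phi> x"
    using x(2) by simp
  then have l: "l \<in> Y" "cY \<phi> x = c x l - \<phi> l"
    unfolding minimizers_def by auto
  have cont: "continuous_on Y (\<lambda>y. c x y - \<phi> y)"
    using c_continuous_snd[OF x(1)] \<phi> by (intro continuous_intros)
  have "c x l - \<phi> l < c x y - \<phi> y" if "y \<in> Y" "y \<noteq> l" for y
  proof -
    have "y \<notin> minimizers \<phi> x"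
      using x(2) that by simp
    then have "cY \<phi> x \<noteq> c x y - \<phi> y"
      using that(1) unfolding minimizers_def by simp
    then show ?thesis
      using cY_le[OF \<phi> x(1) that(1)] l(2) by linarith
  qed
  from near_minimizer_close[OF compact_Y cont this \<open>0 < \<epsilon>\<close>] show ?thesis
    unfolding l(2) .
qed

text \<open>Moving from \<open>x'\<close> to \<open>x\<close> changes the transform and the cost by
  at most \<open>L * dist x' x\<close> each, so a minimizer at \<open>x'\<close> is nearly minimal
  at \<open>x\<close>, where the minimizer is unique.\<close>

lemma minimizer_close:
  assumes \<phi>: "continuous_on Y \<phi>" and x: "x \<in> X" "minimizers \<phi> x = {l}" and "0 < \<epsilon>"
  shows "\<exists>d>0. \<forall>x'\<in>X. dist x' x < d \<longrightarrow> (\<forall>y\<in>minimizers \<phi> x'. dist y l < \<epsilon>)"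
proof -
  obtain \<eta> where \<eta>: "0 < \<eta>" "\<forall>y\<in>Y. c x y - \<phi> y \<le> cY \<phi> x + \<eta> \<longrightarrow> dist y l < \<epsilon>"
    using unique_minimizer_close[OF assms] by auto
  have L: "0 \<le> L" using lipschitz_on_nonneg[OF c_lipschitz] .
  \<comment> \<open>Two errors of size \<open>L * dist x' x\<close> must stay below
    \<open>\<eta>\<close>; the added 1 keeps the denominator positive when
    \<open>L = 0\<close>.\<close>
  have "dist y l < \<epsilon>"
    if x': "x' \<in> X" "dist x' x < \<eta> / (2 * L + 1)" and y: "y \<in> minimizers \<phi> x'" for x' y
  proof -
    have "(2 * L + 1) * dist x' x < \<eta>"
      using x'(2) L by (simp add: field_simps)
    then have d: "2 * (L * dist x' x) < \<eta>"
      using zero_le_dist[of x' x] unfolding distrib_right mult_1 mult.assoc by linarith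
    have y': "y \<in> Y" "cY \<phi> x' = c x' y - \<phi> y"
      using y unfolding minimizers_def by auto
    have "\<bar>cY \<phi> x' - cY \<phi> x\<bar> \<le> L * dist x' x"
      using lipschitz_onD[OF cY_lipschitz[OF \<phi>] x'(1) x(1)] by (simp add: dist_real_def)
    moreover have "\<bar>c x' y - c x y\<bar> \<le> L * dist x' x"
      using c_dist_fst[OF x'(1) x(1) y'(1)] .
    ultimately have "c x y - \<phi> y \<le> cY \<phi> x + \<eta>"
      using y'(2) d by linarith
    then show ?thesis using \<eta>(2) y'(1) by blast
  qed
  moreover have "0 < \<eta> / (2 * L + 1)"
    using \<eta>(1) L by simp
  ultimately show ?thesis
    by blast
qed

text \<open>Continuity on the set of uniqueness is what later makes the candidate transport map
  measurable.\<close>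

lemma continuous_on_unique_minimizer:
  assumes \<phi>: "continuous_on Y \<phi>" and G: "G \<subseteq> X" "\<And>x. x \<in> G \<Longrightarrow> minimizers \<phi> x = {s x}"
  shows "continuous_on G s"
  unfolding continuous_on_iff
proof (intro ballI allI impI)
  fix x and \<epsilon> :: real assume x: "x \<in> G" and "0 < \<epsilon>"
  have "x \<in> X"
    using x G(1) by auto
  obtain d where d: "0 < d" "\<forall>x'\<in>X. dist x' x < d \<longrightarrow> (\<forall>y\<in>minimizers \<phi> x'. dist y (s x) < \<epsilon>)"
    using minimizer_close[OF \<phi> \<open>x \<in> X\<close> G(2)[OF x] \<open>0 < \<epsilon>\<close>] by auto
  have "dist (s x') (s x) < \<epsilon>" if "x' \<in> G" "dist x' x < d" for x'
    using d(2) that G by auto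
  then show "\<exists>d>0. \<forall>x'\<in>G. dist x' x < d \<longrightarrow> dist (s x') (s x) < \<epsilon>"
    using d(1) by blast
qed

end

section \<open>Kantorovich duality\<close>

text \<open>The sigma-algebras of \<open>M\<close> and \<open>N\<close> may exceed the Borel ones
  because the measures used later live on Lebesgue sets.\<close>

locale transport_problem = compact_cost c X Y L + source: finite_measure M + target: finite_measure N
  for c :: "'a::euclidean_space \<Rightarrow> 'b::euclidean_space \<Rightarrow> real" and X Y L
    and M :: "'a measure" and N :: "'b measure" +
  assumes space_M: "space M = X" and sets_M: "sets (restrict_space borel X) \<subseteq> sets M"
    and space_N: "space N = Y" and sets_N: "sets (restrict_space borel Y) \<subseteq> sets N"
    and mass: "measure M X = measure N Y"
begin

lemma measurable_M:
  fixes g :: "'a \<Rightarrow> 'd::topological_space"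
  assumes "continuous_on X g"
  shows "g \<in> borel_measurable M"
  by (rule borel_measurable_subalgebra[OF sets_M])
    (simp_all add: space_M space_restrict_space borel_measurable_continuous_on_restrict assms)

lemma measurable_N:
  fixes g :: "'b \<Rightarrow> 'd::topological_space"
  assumes "continuous_on Y g"
  shows "g \<in> borel_measurable N"
  by (rule borel_measurable_subalgebra[OF sets_N])
    (simp_all add: space_N space_restrict_space borel_measurable_continuous_on_restrict assms)

lemma integrable_M:
  fixes g :: "'a \<Rightarrow> real"
  assumes "continuous_on X g"
  shows "integrable M g"
proof -
  obtain B where "\<And>x. x \<in> X \<Longrightarrow> norm (g x) \<le> B"
    using compact_imp_bounded[OF compact_continuous_image[OF assms compact_X]]
    unfolding bounded_iff by auto
  then have "AE x in M. norm (g x) \<le> B"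
    by (intro AE_I2) (simp add: space_M)
  then show ?thesis
    using measurable_M[OF assms] by (rule source.integrable_const_bound)
qed

lemma integrable_N:
  fixes g :: "'b \<Rightarrow> real"
  assumes "continuous_on Y g"
  shows "integrable N g"
proof -
  obtain B where "\<And>x. x \<in> Y \<Longrightarrow> norm (g x) \<le> B"
    using compact_imp_bounded[OF compact_continuous_image[OF assms compact_Y]]
    unfolding bounded_iff by auto
  then have "AE x in N. norm (g x) \<le> B"
    by (intro AE_I2) (simp add: space_N)
  then show ?thesis
    using measurable_N[OF assms] by (rule target.integrable_const_bound)
qed

section \<open>The dual functional and its maximizers\<close>

text \<open>Kantorovich's dual functional with its first potential eliminated:
  \<open>cY \<phi>\<close> is the largest function whose sum with \<open>\<phi>\<close> stays below
  the cost.\<close>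

definition dual :: "('b \<Rightarrow> real) \<Rightarrow> real" where
  "dual \<phi> = integral\<^sup>L M (cY \<phi>) + integral\<^sup>L N \<phi>"

lemma integral_M_mono:
  fixes g g' :: "'a \<Rightarrow> real"
  assumes "continuous_on X g" "continuous_on X g'" "\<And>x. x \<in> X \<Longrightarrow> g x \<le> g' x + d"
  shows "integral\<^sup>L M g \<le> integral\<^sup>L M g' + d * measure M X"
proof -
  have "integral\<^sup>L M g \<le> integral\<^sup>L M (\<lambda>x. g' x + d)"
    using assms integrable_M by (intro integral_mono) (auto simp: space_M)
  also have "\<dots> = integral\<^sup>L M g' + d * measure M X"
    using assms(2) integrable_M by (subst Bochner_Integration.integral_add) (auto simp: space_M)
  finally show ?thesis .
qed

lemma integral_N_mono:
  fixes g g' :: "'b \<Rightarrow> real"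
  assumes "continuous_on Y g" "continuous_on Y g'" "\<And>x. x \<in> Y \<Longrightarrow> g x \<le> g' x + d"
  shows "integral\<^sup>L N g \<le> integral\<^sup>L N g' + d * measure N Y"
proof -
  have "integral\<^sup>L N g \<le> integral\<^sup>L N (\<lambda>x. g' x + d)"
    using assms integrable_N by (intro integral_mono) (auto simp: space_N)
  also have "\<dots> = integral\<^sup>L N g' + d * measure N Y"
    using assms(2) integrable_N by (subst Bochner_Integration.integral_add) (auto simp: space_N)
  finally show ?thesis .
qed

text \<open>Both masses agree, so the two errors add with a common factor; they may have either
  sign, and opposite ones cancel.\<close>

lemma dual_le:
  assumes "continuous_on Y \<phi>" "continuous_on Y \<phi>'"
    and "\<And>x. x \<in> X \<Longrightarrow> cY \<phi> x \<le> cY \<phi>' x + d" "\<And>y. y \<in> Y \<Longrightarrow> \<phi> y \<le> \<phi>' y + d'"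
  shows "dual \<phi> \<le> dual \<phi>' + (d + d') * measure M X"
  using integral_M_mono[of "cY \<phi>" "cY \<phi>'" d] integral_N_mono[of \<phi> \<phi>' d'] assms cY_continuous mass
  by (simp add: dual_def distrib_right)

lemma dual_le_c_transform:
  assumes "continuous_on Y \<phi>"
  shows "dual \<phi> \<le> dual (cX (cY \<phi>))"
  using dual_le[OF assms, of "cX (cY \<phi>)" 0 0] assms cY_continuous cX_continuous cY_cX_cY le_cX_cY
  by simp

text \<open>Subtracting \<open>a\<close> from \<open>\<phi>\<close> adds \<open>a\<close> to its
  transform, and equal masses cancel the two changes.\<close>

lemma dual_shift:
  assumes "continuous_on Y \<phi>"
  shows "dual (\<lambda>y. \<phi> y - a) = dual \<phi>"
proof -
  have cont: "continuous_on Y (\<lambda>y. \<phi> y - a)"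
    using assms by (intro continuous_intros)
  have 1: "cY (\<lambda>y. \<phi> y - a) x \<le> cY \<phi> x + a" if "x \<in> X" for x
    using cY_diff_le[OF cont assms that, of a] by simp
  have 2: "cY \<phi> x \<le> cY (\<lambda>y. \<phi> y - a) x + - a" if "x \<in> X" for x
    using cY_diff_le[OF assms cont that, of "-a"] by simp
  show ?thesis
    using dual_le[OF cont assms 1, of "-a"] dual_le[OF assms cont 2, of a] by auto
qed

text \<open>The double transform supplies the Lipschitz bound and a shift the zero at
  \<open>y0\<close>; neither lowers \<open>dual\<close>. Maximization may thus be confined to a
  bounded equicontinuous class.\<close>

lemma dual_normalize:
  assumes "continuous_on Y \<phi>" "y0 \<in> Y"
  obtains \<phi>' where "L-lipschitz_on Y \<phi>'" "\<phi>' y0 = 0" "dual \<phi> \<le> dual \<phi>'"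
proof
  let ?h = "cX (cY \<phi>)"
  have lip: "L-lipschitz_on Y ?h"
    using assms(1) cY_continuous cX_lipschitz by blast
  then show "L-lipschitz_on Y (\<lambda>y. ?h y - ?h y0)"
    unfolding lipschitz_on_def by (simp add: dist_real_def)
  show "dual \<phi> \<le> dual (\<lambda>y. ?h y - ?h y0)"
    using dual_le_c_transform[OF assms(1)] dual_shift[OF lipschitz_on_continuous_on[OF lip]] by simp
qed simp

text \<open>On the normalized class \<open>\<phi>\<close> and \<open>cY \<phi>\<close> differ from
  their values for the zero function by at most \<open>L\<close> times the diameter of
  \<open>Y\<close>.\<close>

lemma dual_bounded:
  assumes y0: "y0 \<in> Y"
  shows "bdd_above (dual ` {\<phi>. L-lipschitz_on Y \<phi> \<and> \<phi> y0 = 0})"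
proof -
  define D where "D = L * diameter Y"
  have L: "0 \<le> L" using lipschitz_on_nonneg[OF c_lipschitz] .
  have "dual \<phi> \<le> dual (\<lambda>_. 0) + (D + D) * measure M X" if "L-lipschitz_on Y \<phi>" "\<phi> y0 = 0" for \<phi>
  proof (rule dual_le)
    show cont: "continuous_on Y \<phi>" "continuous_on Y (\<lambda>_. 0 :: real)"
      using lipschitz_on_continuous_on[OF that(1)] by auto
    have abs: "\<bar>\<phi> y\<bar> \<le> D" if "y \<in> Y" for y
    proof -
      have "\<bar>\<phi> y\<bar> \<le> L * dist y y0"
        using lipschitz_onD[OF \<open>L-lipschitz_on Y \<phi>\<close> that y0] \<open>\<phi> y0 = 0\<close> by (simp add: dist_real_def)
      also have "\<dots> \<le> D"
        unfolding D_def using diameter_bounded_bound[OF compact_imp_bounded[OF compact_Y] that y0] L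
        by (simp add: mult_left_mono)
      finally show ?thesis .
    qed
    show "\<phi> y \<le> 0 + D" if "y \<in> Y" for y
      using abs[OF that] by linarith
    show "cY \<phi> x \<le> cY (\<lambda>_. 0) x + D" if "x \<in> X" for x
      using cY_diff_le[OF cont that, of D] abs by fastforce
  qed
  then show ?thesis
    unfolding bdd_above_def by blast
qed

text \<open>The direct method: a maximizing sequence in the normalized class has a uniformly
  convergent subsequence. The double transform of the limit is returned in order to have
  \<open>cX (cY \<phi>) = \<phi>\<close> as well.\<close>

lemma dual_attained:
  obtains \<phi> where "continuous_on Y \<phi>" "cX (cY \<phi>) = \<phi>" "\<And>h. continuous_on Y h \<Longrightarrow> dual h \<le> dual \<phi>"
proof -
  obtain y0 where y0: "y0 \<in> Y" using Y_nonempty by blast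
  define K :: "('b \<Rightarrow> real) set" where "K = {\<phi>. L-lipschitz_on Y \<phi> \<and> \<phi> y0 = 0}"
  have L: "0 \<le> L" using lipschitz_on_nonneg[OF c_lipschitz] .
  then have "(\<lambda>_. 0) \<in> K"
    by (auto simp: K_def intro!: lipschitz_onI)
  have bdd: "bdd_above (dual ` K)"
    unfolding K_def using y0 by (rule dual_bounded)
  have "\<exists>\<phi>\<in>K. Sup (dual ` K) - 1 / Suc n < dual \<phi>" for n
  proof -
    have "dual ` K \<noteq> {}"
      using \<open>(\<lambda>_. 0) \<in> K\<close> by blast
    moreover have "Sup (dual ` K) - 1 / Suc n < Sup (dual ` K)"
      by simp
    ultimately show ?thesis
      using less_cSupE[of "Sup (dual ` K) - 1 / Suc n" "dual ` K"] by blast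
  qed
  then obtain k where k: "\<And>n. k n \<in> K" "\<And>n. Sup (dual ` K) - 1 / Suc n < dual (k n)"
    by metis
  have k_lip: "L-lipschitz_on Y (k n)" and k0: "k n y0 = 0" for n
    using k(1) unfolding K_def by auto
  have k_abs: "norm (k n y) \<le> L * diameter Y" if "y \<in> Y" for n y
  proof -
    have "\<bar>k n y\<bar> \<le> L * dist y y0"
      using lipschitz_onD[OF k_lip that y0] k0 by (simp add: dist_real_def)
    also have "\<dots> \<le> L * diameter Y"
      using diameter_bounded_bound[OF compact_imp_bounded[OF compact_Y] that y0] L
      by (simp add: mult_left_mono)
    finally show ?thesis by simp
  qed
  have equicont: "\<exists>d>0. \<forall>n y. y \<in> Y \<and> norm (x - y) < d \<longrightarrow> norm (k n x - k n y) < e"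
    if "x \<in> Y" "0 < e" for x e
  proof (intro exI[of _ "e / (L + 1)"] conjI allI impI)
    show "0 < e / (L + 1)" using L that by simp
    fix n y assume y: "y \<in> Y \<and> norm (x - y) < e / (L + 1)"
    have "norm (k n x - k n y) \<le> L * norm (x - y)"
      using lipschitz_onD[OF k_lip that(1)] y by (simp add: dist_norm)
    also have "\<dots> \<le> (L + 1) * norm (x - y)"
      by (simp add: mult_right_mono)
    also have "\<dots> < e"
      using y L by (simp add: field_simps)
    finally show "norm (k n x - k n y) < e" .
  qed
  obtain g r where g: "continuous_on Y g" and r: "strict_mono (r :: nat \<Rightarrow> nat)" and
    conv: "\<And>e. 0 < e \<Longrightarrow> \<exists>N. \<forall>n x. n \<ge> N \<and> x \<in> Y \<longrightarrow> norm (k (r n) x - g x) < e"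
    using Arzela_Ascoli[OF compact_Y k_abs equicont] by metis
  have Sup_le: "Sup (dual ` K) \<le> dual g"
  proof (rule field_le_epsilon)
    fix e :: real assume "0 < e"
    \<comment> \<open>With this \<open>d\<close> the uniform error costs at most
      \<open>e / 2\<close> in \<open>dual\<close>; the added 1 covers zero mass.\<close>
    define d where "d = e / (2 * (2 * measure M X + 1))"
    have "0 < d" using \<open>0 < e\<close> by (simp add: d_def add_nonneg_pos)
    obtain n1 where n1: "\<forall>n x. n \<ge> n1 \<and> x \<in> Y \<longrightarrow> norm (k (r n) x - g x) < d"
      using conv[OF \<open>0 < d\<close>] by auto
    obtain n2 where n2: "1 / Suc n2 < e / 2"
      using \<open>0 < e\<close> nat_approx_posE[of "e / 2"] by auto
    \<comment> \<open>From \<open>n1\<close> on the subsequence is uniformly \<open>d\<close>-close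
      to \<open>g\<close>; from \<open>n2\<close> on its dual values are within \<open>e / 2\<close>
      of the supremum, as \<open>n \<le> r n\<close>.\<close>
    define n where "n = max n1 n2"
    have near: "\<bar>k (r n) y - g y\<bar> \<le> d" if "y \<in> Y" for y
      using n1[rule_format, of n y] that by (simp add: n_def)
    have kc: "continuous_on Y (k (r n))"
      using k_lip lipschitz_on_continuous_on by blast
    have "dual (k (r n)) \<le> dual g + (d + d) * measure M X"
    proof (rule dual_le[OF kc g])
      show "k (r n) y \<le> g y + d" if "y \<in> Y" for y
        using near[OF that] by linarith
      show "cY (k (r n)) x \<le> cY g x + d" if "x \<in> X" for x
        using cY_diff_le[OF kc g that, of d] near by fastforce
    qed
    moreover have "(d + d) * measure M X \<le> e / 2"
    proof -
      have "(d + d) * measure M X \<le> d * (2 * measure M X + 1)"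
        using \<open>0 < d\<close> by (simp add: algebra_simps)
      also have "\<dots> = e / 2"
      proof -
        have "2 * measure M X + 1 \<noteq> 0"
          using measure_nonneg[of M X] by linarith
        then show ?thesis by (simp add: d_def divide_simps)
      qed
      finally show ?thesis .
    qed
    moreover have "1 / Suc (r n) \<le> 1 / Suc n2"
    proof -
      have "n2 \<le> r n"
        using seq_suble[OF r, of n] by (simp add: n_def)
      then show ?thesis by (simp add: frac_le)
    qed
    ultimately show "Sup (dual ` K) \<le> dual g + e"
      using k(2)[of "r n"] n2 by linarith
  qed
  have max: "dual h \<le> dual g" if h: "continuous_on Y h" for h
  proof -
    obtain h' where h': "L-lipschitz_on Y h'" "h' y0 = 0" "dual h \<le> dual h'"
      using dual_normalize[OF h y0] .
    then have "dual h' \<le> Sup (dual ` K)"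
      by (intro cSup_upper bdd) (auto simp: K_def)
    then show ?thesis
      using h'(3) Sup_le by linarith
  qed
  show ?thesis
  proof (rule that[of "cX (cY g)"])
    show cont: "continuous_on Y (cX (cY g))"
      using g cY_continuous cX_continuous by blast
    show "cX (cY (cX (cY g))) = cX (cY g)"
      by (rule cX_cong) (rule cY_cX_cY[OF g])
    show "dual h \<le> dual (cX (cY g))" if "continuous_on Y h" for h
      using max[OF that] dual_le_c_transform[OF g] by linarith
  qed
qed

text \<open>First variation of the dual functional: the difference quotients of \<open>t \<mapsto> cY (\<phi> + t h) x\<close> at \<open>0\<close> tend
  to \<open>- h (s x)\<close>, so maximality of \<open>\<phi>\<close> says that \<open>s\<close> preserves integrals of \<open>h\<close>.\<close>

lemma optimal_push_forward:
  assumes \<phi>: "continuous_on Y \<phi>" and opt: "\<And>h. continuous_on Y h \<Longrightarrow> dual h \<le> dual \<phi>"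
    and s: "s \<in> borel_measurable M" and unique: "AE x in M. minimizers \<phi> x = {s x}"
  shows "distr M borel s = distr N borel (\<lambda>y. y)"
proof -
  have id: "(\<lambda>y. y) \<in> borel_measurable N"
    by (intro measurable_N continuous_intros)
  \<comment> \<open>One inequality for all \<open>h\<close> suffices, since replacing
    \<open>h\<close> by \<open>- h\<close> reverses it.\<close>
  have ineq: "(\<integral>y. h y \<partial>N) \<le> (\<integral>x. h (s x) \<partial>M)"
    if h: "continuous_on UNIV h" and B: "\<And>y. \<bar>h y\<bar> \<le> B" for h :: "'b \<Rightarrow> real" and B
  proof -
    have hY: "continuous_on Y h"
      using h by (rule continuous_on_subset) auto
    have h_meas: "h \<in> borel_measurable borel"
      using h by (rule borel_measurable_continuous_onI)
    have "0 \<le> B" using B[of undefined] by linarith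
    define t where "t n = 1 / real (Suc n)" for n
    have t_pos: "0 < t n" for n by (simp add: t_def)
    define \<phi>t where "\<phi>t n y = \<phi> y + t n * h y" for n y
    have \<phi>t: "continuous_on Y (\<phi>t n)" for n
      unfolding \<phi>t_def using \<phi> hY by (intro continuous_intros)
    \<comment> \<open>Difference quotients of the transform; the increments \<open>t n\<close> are
      positive, so maximality yields a one-sided inequality.\<close>
    define q where "q n x = (cY (\<phi>t n) x - cY \<phi> x) / t n" for n x
    have q_cont: "continuous_on X (q n)" for n
      unfolding q_def using t_pos[of n] \<phi> \<phi>t cY_continuous by (intro continuous_intros) auto
    have t_le: "\<bar>t n * h y\<bar> \<le> t n * B" for n y
      using B[of y] t_pos[of n] by (simp add: abs_mult)
    have q_bound: "\<bar>q n x\<bar> \<le> B" if "x \<in> X" for n x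
    proof -
      have "cY (\<phi>t n) x - cY \<phi> x \<le> t n * B"
        using t_le[of n] by (intro cY_diff_le \<phi> \<phi>t that) (auto simp: \<phi>t_def abs_le_iff minus_le_iff)
      moreover have "cY \<phi> x - cY (\<phi>t n) x \<le> t n * B"
        using t_le[of n] by (intro cY_diff_le \<phi> \<phi>t that) (auto simp: \<phi>t_def abs_le_iff)
      ultimately have "\<bar>cY (\<phi>t n) x - cY \<phi> x\<bar> \<le> t n * B"
        by linarith
      then show ?thesis
        using t_pos[of n] by (simp add: q_def field_simps)
    qed
    have q_int: "integral\<^sup>L M (q n) + integral\<^sup>L N h \<le> 0" for n
    proof -
      have "integral\<^sup>L M (\<lambda>x. cY (\<phi>t n) x - cY \<phi> x) = integral\<^sup>L M (cY (\<phi>t n)) - integral\<^sup>L M (cY \<phi>)"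
        using \<phi> \<phi>t cY_continuous integrable_M by (intro Bochner_Integration.integral_diff) auto
      moreover have "integral\<^sup>L N (\<phi>t n) = integral\<^sup>L N \<phi> + t n * integral\<^sup>L N h"
        unfolding \<phi>t_def using \<phi> hY integrable_N by (subst Bochner_Integration.integral_add) auto
      moreover have "dual (\<phi>t n) \<le> dual \<phi>"
        by (rule opt[OF \<phi>t])
      ultimately have "integral\<^sup>L M (\<lambda>x. cY (\<phi>t n) x - cY \<phi> x) + t n * integral\<^sup>L N h \<le> 0"
        by (simp add: dual_def)
      moreover have "integral\<^sup>L M (\<lambda>x. cY (\<phi>t n) x - cY \<phi> x) = t n * integral\<^sup>L M (q n)"
        unfolding q_def using t_pos[of n] by simp
      ultimately have "t n * (integral\<^sup>L M (q n) + integral\<^sup>L N h) \<le> 0"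
        by (simp add: algebra_simps)
      then show ?thesis
        using t_pos[of n] by (simp add: mult_le_0_iff)
    qed
    have q_lim: "(\<lambda>n. q n x) \<longlonglongrightarrow> - h (s x)" if x: "x \<in> X" "minimizers \<phi> x = {s x}" for x
    proof (rule LIMSEQ_I)
      fix e :: real assume "0 < e"
      have "s x \<in> minimizers \<phi> x" using x(2) by simp
      then have sx: "s x \<in> Y" "cY \<phi> x = c x (s x) - \<phi> (s x)"
        unfolding minimizers_def by auto
      obtain \<epsilon> where \<epsilon>: "0 < \<epsilon>" "\<And>y. dist y (s x) < \<epsilon> \<Longrightarrow> dist (h y) (h (s x)) < e"
        using h \<open>0 < e\<close> unfolding continuous_on_iff by (metis UNIV_I)
      obtain \<eta> where \<eta>: "0 < \<eta>" "\<forall>y\<in>Y. c x y - \<phi> y \<le> cY \<phi> x + \<eta> \<longrightarrow> dist y (s x) < \<epsilon>"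
        using unique_minimizer_close[OF \<phi> x \<epsilon>(1)] by auto
      \<comment> \<open>A perturbation bounded by \<open>t n * B\<close> shifts a near-minimum by at
        most \<open>2 * t n * B\<close>, which must stay below \<open>\<eta>\<close>; the added 1
        covers \<open>B = 0\<close>.\<close>
      obtain m where m: "1 / Suc m < \<eta> / (2 * B + 1)"
        using nat_approx_posE[of "\<eta> / (2 * B + 1)"] \<eta>(1) \<open>0 \<le> B\<close> by auto
      have "norm (q n x - - h (s x)) < e" if "n \<ge> m" for n
      proof -
        have "t n \<le> 1 / Suc m"
          using that by (simp add: t_def frac_le)
        then have "t n < \<eta> / (2 * B + 1)"
          using m by linarith
        then have "t n * (2 * B + 1) < \<eta>"
          using \<open>0 \<le> B\<close> by (simp add: pos_less_divide_eq)
        then have tB: "2 * (t n * B) \<le> \<eta>"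
          using t_pos[of n] by (simp add: algebra_simps)
        \<comment> \<open>The quotient is squeezed: testing with \<open>s x\<close> bounds it above
          by \<open>- h (s x)\<close>, and the perturbed minimizer \<open>y\<close> bounds it below
          by \<open>- h y\<close>. As \<open>y\<close> is nearly minimal for \<open>\<phi>\<close>,
          it is close to \<open>s x\<close>.\<close>
        obtain y where y: "y \<in> Y" "cY (\<phi>t n) x = c x y - \<phi>t n y"
          using cY_attained[OF \<phi>t x(1)] .
        have upper: "cY (\<phi>t n) x \<le> cY \<phi> x - t n * h (s x)"
          using cY_le[OF \<phi>t x(1) sx(1), of n] sx(2) by (simp add: \<phi>t_def)
        have lower: "cY \<phi> x - t n * h y \<le> cY (\<phi>t n) x"
          using cY_le[OF \<phi> x(1) y(1)] y(2) by (simp add: \<phi>t_def)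
        have "c x y - \<phi> y \<le> cY \<phi> x + \<eta>"
          using upper y(2) tB t_le[of n y] t_le[of n "s x"] unfolding \<phi>t_def by linarith
        then have "dist (h y) (h (s x)) < e"
          using \<eta>(2) y(1) \<epsilon>(2) by blast
        moreover have "q n x \<le> - h (s x)" "- h y \<le> q n x"
          using upper lower t_pos[of n] by (auto simp: q_def field_simps)
        ultimately show ?thesis
          by (simp add: dist_real_def abs_if split: if_splits)
      qed
      then show "\<exists>m. \<forall>n\<ge>m. norm (q n x - - h (s x)) < e"
        by blast
    qed
    have "(\<lambda>n. integral\<^sup>L M (q n)) \<longlonglongrightarrow> integral\<^sup>L M (\<lambda>x. - h (s x))"
    proof (rule integral_dominated_convergence[where w = "\<lambda>_. B"])
      show "(\<lambda>x. - h (s x)) \<in> borel_measurable M"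
        using measurable_compose[OF s h_meas] by simp
      show "q n \<in> borel_measurable M" for n
        using q_cont by (rule measurable_M)
      show "AE x in M. (\<lambda>n. q n x) \<longlonglongrightarrow> - h (s x)"
        using unique AE_space by eventually_elim (simp add: q_lim space_M)
      show "AE x in M. norm (q n x) \<le> B" for n
        by (intro AE_I2) (simp add: q_bound space_M)
    qed simp
    then have "integral\<^sup>L M (\<lambda>x. - h (s x)) + integral\<^sup>L N h \<le> 0"
      by (intro LIMSEQ_le_const2[OF tendsto_add[OF _ tendsto_const]]) (use q_int in auto)
    then show ?thesis by simp
  qed
  show ?thesis
  proof (rule finite_measure_eqI_continuous)
    show "finite_measure (distr M borel s)" "finite_measure (distr N borel (\<lambda>y. y))"
      using s id source.finite_measure_distr target.finite_measure_distr by blast+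
    fix h :: "'b \<Rightarrow> real" assume h: "continuous_on UNIV h" "\<forall>x. 0 \<le> h x \<and> h x \<le> 1"
    have "h \<in> borel_measurable borel"
      using h(1) by (rule borel_measurable_continuous_onI)
    moreover have "(\<integral>y. h y \<partial>N) \<le> (\<integral>x. h (s x) \<partial>M)"
      by (rule ineq[OF h(1), of 1]) (use h(2) in \<open>auto simp: abs_le_iff intro: order_trans[of _ 0]\<close>)
    moreover have "(\<integral>y. - h y \<partial>N) \<le> (\<integral>x. - h (s x) \<partial>M)"
      by (rule ineq[of "\<lambda>y. - h y" 1]) (use h in \<open>auto simp: abs_le_iff intro!: continuous_intros intro: order_trans[of _ 0]\<close>)
    ultimately show "integral\<^sup>L (distr M borel s) h = integral\<^sup>L (distr N borel (\<lambda>y. y)) h"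
      using s id by (simp add: integral_distr)
  qed simp_all
qed

section \<open>Costs of transport maps and the duality gap\<close>

lemma integrable_cost:
  assumes T: "T \<in> borel_measurable M" "\<And>x. x \<in> X \<Longrightarrow> T x \<in> Y"
  shows "integrable M (\<lambda>x. c x (T x))"
proof -
  \<comment> \<open>\<open>c\<close> is controlled on \<open>X \<times> Y\<close> only; cutting it
    off outside this closed set gives a Borel function on the whole product.\<close>
  let ?c = "\<lambda>p. indicator (X \<times> Y) p *\<^sub>R (case p of (x, y) \<Rightarrow> c x y)"
  have "compact (X \<times> Y)"
    using compact_X compact_Y by (rule compact_Times)
  then obtain B where B: "\<And>x y. x \<in> X \<Longrightarrow> y \<in> Y \<Longrightarrow> norm (c x y) \<le> B"
    using compact_imp_bounded[OF compact_continuous_image[OF c_continuous]]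
    unfolding bounded_iff by auto
  have "?c \<in> borel_measurable borel"
    using c_continuous \<open>compact (X \<times> Y)\<close>
    by (intro borel_measurable_continuous_on_indicator) (auto simp: compact_imp_closed)
  moreover have "(\<lambda>x. (x, T x)) \<in> borel_measurable M"
    using T(1) measurable_M[OF continuous_on_id] by (intro borel_measurable_Pair) auto
  ultimately have "(\<lambda>x. ?c (x, T x)) \<in> borel_measurable M"
    by (rule measurable_compose[rotated])
  moreover have "?c (x, T x) = c x (T x)" if "x \<in> space M" for x
    using that T(2) by (simp add: space_M)
  ultimately have "(\<lambda>x. c x (T x)) \<in> borel_measurable M"
    by (subst measurable_cong[where g = "\<lambda>x. ?c (x, T x)"]) simp_all
  moreover have "AE x in M. norm (c x (T x)) \<le> B"
    using B T(2) by (intro AE_I2) (simp add: space_M)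
  ultimately show ?thesis
    by (intro source.integrable_const_bound)
qed

lemma push_forward_integral:
  assumes T: "T \<in> borel_measurable M" "\<And>x. x \<in> X \<Longrightarrow> T x \<in> Y"
    and push: "distr M borel T = distr N borel (\<lambda>y. y)"
    and \<phi>: "continuous_on Y (\<phi> :: 'b \<Rightarrow> real)"
  shows "integrable M (\<lambda>x. \<phi> (T x))" "(\<integral>x. \<phi> (T x) \<partial>M) = (\<integral>y. \<phi> y \<partial>N)"
proof -
  \<comment> \<open>Cutting \<open>\<phi>\<close> off outside \<open>Y\<close> makes it Borel on the
    whole space, where the push-forwards live.\<close>
  let ?f = "\<lambda>y. indicator Y y *\<^sub>R \<phi> y :: real"
  have f: "?f \<in> borel_measurable borel"
    using \<phi> compact_Y by (intro borel_measurable_continuous_on_indicator) (auto simp: compact_imp_closed)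
  have id: "(\<lambda>y. y) \<in> borel_measurable N"
    by (intro measurable_N continuous_intros)
  have eqM: "?f (T x) = \<phi> (T x)" if "x \<in> space M" for x
    using that T(2) by (simp add: space_M)
  have eqN: "?f y = \<phi> y" if "y \<in> space N" for y
    using that by (simp add: space_N)
  have "integrable N ?f"
    by (subst Bochner_Integration.integrable_cong[OF refl eqN]) (use integrable_N[OF \<phi>] in simp_all)
  then have "integrable (distr M borel T) ?f"
    unfolding push using integrable_distr_eq[OF id f] by simp
  then have "integrable M (\<lambda>x. ?f (T x))"
    using integrable_distr_eq[OF T(1) f] by simp
  then show "integrable M (\<lambda>x. \<phi> (T x))"
    by (subst Bochner_Integration.integrable_cong[OF refl eqM[symmetric]]) simp_all
  have "(\<integral>x. \<phi> (T x) \<partial>M) = (\<integral>x. ?f (T x) \<partial>M)"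
    using eqM by (intro Bochner_Integration.integral_cong) auto
  also have "\<dots> = integral\<^sup>L (distr M borel T) ?f"
    by (rule integral_distr[OF T(1) f, symmetric])
  also have "\<dots> = (\<integral>y. ?f y \<partial>N)"
    unfolding push by (rule integral_distr[OF id f])
  also have "\<dots> = (\<integral>y. \<phi> y \<partial>N)"
    using eqN by (intro Bochner_Integration.integral_cong) auto
  finally show "(\<integral>x. \<phi> (T x) \<partial>M) = (\<integral>y. \<phi> y \<partial>N)" .
qed

text \<open>Both maps have the same push-forward, so the integral of the nonnegative duality gap
  depends on the map only through its cost. It vanishes for \<open>s\<close>, hence also for
  \<open>T\<close>, which costs no more, and the gap of \<open>T\<close> is zero almost
  everywhere.\<close>

lemma optimal_in_minimizers:
  assumes \<phi>: "continuous_on Y \<phi>"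
    and s: "s \<in> borel_measurable M" "\<And>x. x \<in> X \<Longrightarrow> s x \<in> Y" "distr M borel s = distr N borel (\<lambda>y. y)"
      "AE x in M. s x \<in> minimizers \<phi> x"
    and T: "T \<in> borel_measurable M" "\<And>x. x \<in> X \<Longrightarrow> T x \<in> Y" "distr M borel T = distr N borel (\<lambda>y. y)"
    and le: "(\<integral>x. c x (T x) \<partial>M) \<le> (\<integral>x. c x (s x) \<partial>M)"
  shows "AE x in M. T x \<in> minimizers \<phi> x"
proof -
  note int = integrable_M[OF cY_continuous[OF \<phi>]]
  define gap where "gap r x = c x (r x) - \<phi> (r x) - cY \<phi> x" for r x
  have gap_int: "integrable M (gap r)"
    and gap_integral: "integral\<^sup>L M (gap r) = (\<integral>x. c x (r x) \<partial>M) - (\<integral>y. \<phi> y \<partial>N) - (\<integral>x. cY \<phi> x \<partial>M)"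
    if "r \<in> borel_measurable M" "\<And>x. x \<in> X \<Longrightarrow> r x \<in> Y" "distr M borel r = distr N borel (\<lambda>y. y)" for r
    using integrable_cost[OF that(1,2)] push_forward_integral[OF that \<phi>] int
    unfolding gap_def by simp_all
  have "AE x in M. gap s x = 0"
    using s(4) by eventually_elim (simp add: gap_def minimizers_def)
  then have "integral\<^sup>L M (gap s) = 0"
    by (rule integral_eq_zero_AE)
  then have "integral\<^sup>L M (gap T) \<le> 0"
    using gap_integral[OF s(1-3)] gap_integral[OF T] le by linarith
  moreover have nonneg: "AE x in M. 0 \<le> gap T x"
    using cY_le[OF \<phi>] T(2) by (intro AE_I2) (simp add: space_M gap_def)
  moreover have "0 \<le> integral\<^sup>L M (gap T)"
    using nonneg by (rule integral_nonneg_AE)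
  ultimately have "integral\<^sup>L M (gap T) = 0"
    by linarith
  then have "AE x in M. gap T x = 0"
    using integral_nonneg_eq_0_iff_AE[OF gap_int[OF T] nonneg] by simp
  then show ?thesis
    using AE_space by eventually_elim (use T(2) in \<open>auto simp: gap_def minimizers_def space_M\<close>)
qed

end

section \<open>Twisted costs\<close>

text \<open>Uniform continuity of \<open>G\<close> on the compact product gives one radius for all
  \<open>y\<close>. The gradient is available at interior \<open>y\<close>; the estimate extends to
  the other \<open>y\<close> by continuity.\<close>

lemma C1_with_gradient_partial_uniform:
  fixes g :: "'a::euclidean_space \<times> 'b::euclidean_space \<Rightarrow> real"
  assumes C1: "C1_with_gradient g G (X \<times> Y)" and X: "compact X"
    and Y: "compact Y" "Y \<subseteq> closure (interior Y)"
    and x: "x \<in> interior X" and "0 < \<epsilon>"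
  shows "\<exists>\<delta>>0. \<forall>z. dist z x < \<delta> \<longrightarrow> z \<in> X \<and>
    (\<forall>y\<in>Y. \<bar>g (z, y) - g (x, y) - (z - x) \<bullet> fst (G (x, y))\<bar> \<le> \<epsilon> * norm (z - x))"
proof -
  have g_cont: "continuous_on (X \<times> Y) g" and G_cont: "continuous_on (X \<times> Y) G"
    and G: "\<And>p. p \<in> interior (X \<times> Y) \<Longrightarrow> GDERIV g p :> G p"
    using C1 unfolding C1_with_gradient_def by auto
  have "uniformly_continuous_on (X \<times> Y) G"
    using G_cont compact_Times[OF X Y(1)] by (rule compact_uniformly_continuous)
  then obtain d where d: "0 < d" "\<And>p q. p \<in> X \<times> Y \<Longrightarrow> q \<in> X \<times> Y \<Longrightarrow> dist p q < d \<Longrightarrow> dist (G p) (G q) < \<epsilon>"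
    using \<open>0 < \<epsilon>\<close> unfolding uniformly_continuous_on_def by metis
  obtain r where r: "0 < r" "ball x r \<subseteq> interior X"
    using x open_interior open_contains_ball by blast
  define S where "S = ball x (min d r)"
  have S: "S \<subseteq> interior X"
    using r by (auto simp: S_def)
  then have S': "S \<subseteq> X"
    using interior_subset by blast
  have "x \<in> S"
    using d(1) r(1) by (simp add: S_def)
  have inner: "\<bar>g (z, y) - g (x, y) - (z - x) \<bullet> fst (G (x, y))\<bar> \<le> \<epsilon> * norm (z - x)"
    if z: "z \<in> S" and y: "y \<in> interior Y" for z y
  proof -
    have "y \<in> Y"
      using y interior_subset by auto
    have deriv: "((\<lambda>z. g (z, y)) has_derivative (\<lambda>h. h \<bullet> fst (G (z, y)))) (at z within S)" if "z \<in> S" for z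
    proof -
      have "(z, y) \<in> interior (X \<times> Y)"
        using that S y by (auto simp: interior_Times)
      then have "(g has_derivative (\<lambda>h. h \<bullet> G (z, y))) (at (z, y))"
        using G unfolding gderiv_def by blast
      moreover have "((\<lambda>z. (z, y)) has_derivative (\<lambda>h. (h, 0))) (at z within S)"
        by (auto intro!: derivative_eq_intros)
      ultimately show ?thesis
        by (auto dest!: has_derivative_compose simp: inner_prod_def)
    qed
    \<comment> \<open>Mean value inequality on the convex ball \<open>S\<close>, where the partial
      gradient stays within \<open>\<epsilon>\<close> of its value at \<open>x\<close>.\<close>
    have "norm (g (z, y) - g (x, y) - (z - x) \<bullet> fst (G (x, y))) \<le> norm (z - x) * \<epsilon>"
    proof (rule differentiable_bound_linearization[where f = "\<lambda>z. g (z, y)" and f' = "\<lambda>z h. h \<bullet> fst (G (z, y))", OF _ deriv])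
      show "x + t *\<^sub>R (z - x) \<in> S" if "t \<in> {0..1}" for t
      proof -
        have "convex S" by (simp add: S_def)
        then show ?thesis
          using that z \<open>x \<in> S\<close> convexD_alt[of S x z t] by (simp add: algebra_simps)
      qed
      show "x \<in> S" by fact
      show "onorm ((\<lambda>h. h \<bullet> fst (G (w, y))) - (\<lambda>h. h \<bullet> fst (G (x, y)))) \<le> \<epsilon>" if "w \<in> S" for w
      proof (rule onorm_bound)
        have "dist (G (w, y)) (G (x, y)) < \<epsilon>"
          using that S' \<open>x \<in> S\<close> \<open>y \<in> Y\<close>
          by (intro d(2)) (auto simp: S_def dist_Pair_Pair dist_commute)
        then have "norm (fst (G (w, y)) - fst (G (x, y))) \<le> \<epsilon>"
          using dist_fst_le[of "G (w, y)" "G (x, y)"] by (simp add: dist_norm)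
        then have *: "norm h * norm (fst (G (w, y)) - fst (G (x, y))) \<le> norm h * \<epsilon>" for h :: 'a
          by (rule mult_left_mono) simp
        show "norm (((\<lambda>h. h \<bullet> fst (G (w, y))) - (\<lambda>h. h \<bullet> fst (G (x, y)))) h) \<le> \<epsilon> * norm h" for h
          using Cauchy_Schwarz_ineq2[of h "fst (G (w, y)) - fst (G (x, y))"] *[of h]
          by (simp add: inner_diff_right mult.commute)
      qed (use \<open>0 < \<epsilon>\<close> in simp)
    qed
    then show ?thesis
      by (simp add: mult.commute)
  qed
  have clos: "closure (interior Y) = Y"
    using Y closure_minimal[OF interior_subset compact_imp_closed[OF Y(1)]] by auto
  have "\<bar>g (z, y) - g (x, y) - (z - x) \<bullet> fst (G (x, y))\<bar> \<le> \<epsilon> * norm (z - x)"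
    if z: "z \<in> S" and y: "y \<in> Y" for z y
  proof (rule continuous_le_on_closure[where S = "interior Y" and f = "\<lambda>y. \<bar>g (z, y) - g (x, y) - (z - x) \<bullet> fst (G (x, y))\<bar>"])
    have "z \<in> X" "x \<in> X" using z \<open>x \<in> S\<close> S' by auto
    then show "continuous_on (closure (interior Y)) (\<lambda>y. \<bar>g (z, y) - g (x, y) - (z - x) \<bullet> fst (G (x, y))\<bar>)"
      unfolding clos
      by (intro continuous_on_rabs continuous_on_diff continuous_on_inner continuous_on_const continuous_on_fst
          continuous_on_compose2[OF g_cont continuous_on_Pair] continuous_on_compose2[OF G_cont continuous_on_Pair]
          continuous_on_id) auto
  qed (use y inner[OF z] clos in auto)
  then show ?thesis
    using d(1) r(1) S' by (intro exI[of _ "min d r"]) (auto simp: S_def dist_commute)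
qed

text \<open>For \<open>y\<close> on the boundary this identifies the continuous extension
  \<open>G\<close> with an actual partial derivative.\<close>

lemma C1_with_gradient_partial:
  fixes g :: "'a::euclidean_space \<times> 'b::euclidean_space \<Rightarrow> real"
  assumes "C1_with_gradient g G (X \<times> Y)" "compact X" "compact Y" "Y \<subseteq> closure (interior Y)"
    and "x \<in> interior X" "y \<in> Y"
  shows "GDERIV (\<lambda>x. g (x, y)) x :> fst (G (x, y))"
  unfolding gderiv_def has_derivative_at_alt
proof (intro conjI allI impI)
  show "bounded_linear (\<lambda>h. h \<bullet> fst (G (x, y)))"
    by (rule bounded_linear_inner_left)
  fix e :: real assume "0 < e"
  from C1_with_gradient_partial_uniform[OF assms(1-5) this]
  show "\<exists>d>0. \<forall>z. norm (z - x) < d \<longrightarrow>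
      norm (g (z, y) - g (x, y) - (z - x) \<bullet> fst (G (x, y))) \<le> e * norm (z - x)"
    using \<open>y \<in> Y\<close> unfolding dist_norm real_norm_def by blast
qed

text \<open>\<open>Y_closure\<close> ties \<open>Dc\<close> over boundary points of \<open>Y\<close>
  to gradients at interior points, so that at interior \<open>x\<close> the twist condition speaks
  of the partial gradients of \<open>c\<close> for all \<open>y\<close> in \<open>Y\<close>.\<close>

locale twisted_cost = compact_cost c X Y L
  for c :: "'a::euclidean_space \<Rightarrow> 'b::euclidean_space \<Rightarrow> real" and X Y L +
  fixes Dc :: "'a \<times> 'b \<Rightarrow> 'a \<times> 'b"
  assumes Y_closure: "Y \<subseteq> closure (interior Y)"
    and c_C1: "C1_with_gradient (\<lambda>(x, y). c x y) Dc (X \<times> Y)"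
    and c_twist: "\<And>x. x \<in> X \<Longrightarrow> inj_on (\<lambda>y. fst (Dc (x, y))) Y"
begin

lemma c_partial_uniform:
  assumes "x \<in> interior X" "0 < \<epsilon>"
  shows "\<exists>\<delta>>0. \<forall>z. dist z x < \<delta> \<longrightarrow> z \<in> X \<and>
    (\<forall>y\<in>Y. \<bar>c z y - c x y - (z - x) \<bullet> fst (Dc (x, y))\<bar> \<le> \<epsilon> * norm (z - x))"
  using C1_with_gradient_partial_uniform[OF c_C1 compact_X compact_Y Y_closure assms] by simp

lemma cY_upper:
  assumes \<phi>: "continuous_on Y \<phi>" and z: "z \<in> X" and y: "y \<in> minimizers \<phi> x"
    and "\<forall>y\<in>Y. \<bar>c z y - c x y - (z - x) \<bullet> fst (Dc (x, y))\<bar> \<le> \<epsilon> * norm (z - x)"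
  shows "cY \<phi> z \<le> cY \<phi> x + (z - x) \<bullet> fst (Dc (x, y)) + \<epsilon> * norm (z - x)"
proof -
  have y': "y \<in> Y" "cY \<phi> x = c x y - \<phi> y"
    using y unfolding minimizers_def by auto
  have "\<bar>c z y - c x y - (z - x) \<bullet> fst (Dc (x, y))\<bar> \<le> \<epsilon> * norm (z - x)"
    using assms(4) y'(1) by blast
  then show ?thesis
    using cY_le[OF \<phi> z y'(1)] y'(2) by linarith
qed

text \<open>As a function of its first argument, \<open>c\<close> at a fixed minimizer
  \<open>y\<close>, lowered by \<open>\<phi> y\<close>, touches \<open>cY \<phi>\<close> from above
  at \<open>x\<close>; its gradient there is a supergradient.\<close>

lemma supergradient_cY:
  assumes \<phi>: "continuous_on Y \<phi>" and x: "x \<in> interior X" and y: "y \<in> minimizers \<phi> x"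
  shows "supergradient (cY \<phi>) x (fst (Dc (x, y)))"
  unfolding supergradient_def
proof (intro allI impI)
  fix \<epsilon> :: real assume "0 < \<epsilon>"
  then obtain \<delta> where \<delta>: "0 < \<delta>" "\<forall>z. dist z x < \<delta> \<longrightarrow> z \<in> X \<and>
    (\<forall>y\<in>Y. \<bar>c z y - c x y - (z - x) \<bullet> fst (Dc (x, y))\<bar> \<le> \<epsilon> * norm (z - x))"
    using c_partial_uniform[OF x] by auto
  have "cY \<phi> z \<le> cY \<phi> x + fst (Dc (x, y)) \<bullet> (z - x) + \<epsilon> * norm (z - x)" if "dist z x < \<delta>" for z
    unfolding inner_commute[of "fst (Dc (x, y))"] using \<delta>(2) that by (intro cY_upper[OF \<phi> _ y]) auto
  then show "\<forall>\<^sub>F z in nhds x. cY \<phi> z \<le> cY \<phi> x + fst (Dc (x, y)) \<bullet> (z - x) + \<epsilon> * norm (z - x)"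
    unfolding eventually_nhds_metric using \<delta>(1) by blast
qed

text \<open>Distinct minimizers yield distinct supergradients by the twist condition.\<close>

lemma negligible_minimizers_nonunique:
  assumes \<phi>: "continuous_on Y \<phi>"
  shows "negligible {x \<in> interior X. \<nexists>y. minimizers \<phi> x = {y}}"
proof (rule negligible_subset[OF negligible_supergradient_nonunique[OF compact_X cY_continuous[OF \<phi>]]])
  show "{x \<in> interior X. \<nexists>y. minimizers \<phi> x = {y}} \<subseteq>
    {x \<in> interior X. \<exists>p q. supergradient (cY \<phi>) x p \<and> supergradient (cY \<phi>) x q \<and> p \<noteq> q}"
  proof clarify
    fix x assume x: "x \<in> interior X" and nonunique: "\<nexists>y. minimizers \<phi> x = {y}"
    have "x \<in> X" using x interior_subset by auto
    obtain y where y: "y \<in> minimizers \<phi> x"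
      using minimizers_nonempty[OF \<phi> \<open>x \<in> X\<close>] by auto
    then obtain y' where y': "y' \<in> minimizers \<phi> x" "y \<noteq> y'"
      using nonunique by blast
    have "y \<in> Y" "y' \<in> Y"
      using y y' unfolding minimizers_def by auto
    then have "fst (Dc (x, y)) \<noteq> fst (Dc (x, y'))"
      using inj_onD[OF c_twist[OF \<open>x \<in> X\<close>]] y'(2) by blast
    then show "\<exists>p q. supergradient (cY \<phi>) x p \<and> supergradient (cY \<phi>) x q \<and> p \<noteq> q"
      using supergradient_cY[OF \<phi> x y] supergradient_cY[OF \<phi> x y'(1)] by blast
  qed
qed

text \<open>The supergradient bound is the upper half. For the lower half a minimizer
  \<open>w\<close> at \<open>z\<close> competes at \<open>x\<close>; it lies near \<open>y\<close>
  by stability, so its partial gradient is close to that of \<open>y\<close>.\<close>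

lemma GDERIV_cY:
  assumes \<phi>: "continuous_on Y \<phi>" and x: "x \<in> interior X" and y: "minimizers \<phi> x = {y}"
  shows "GDERIV (cY \<phi>) x :> fst (Dc (x, y))"
  unfolding gderiv_def has_derivative_at_alt
proof (intro conjI allI impI)
  let ?p = "\<lambda>y. fst (Dc (x, y))"
  show "bounded_linear (\<lambda>h. h \<bullet> ?p y)"
    by (rule bounded_linear_inner_left)
  fix e :: real assume "0 < e"
  have xX: "x \<in> X" using x interior_subset by auto
  have yx: "y \<in> minimizers \<phi> x" using y by simp
  then have yY: "y \<in> Y" unfolding minimizers_def by auto
  have "continuous_on (X \<times> Y) Dc"
    using c_C1 unfolding C1_with_gradient_def by auto
  moreover have "continuous_on Y (\<lambda>y. (x, y))" "(\<lambda>y. (x, y)) ` Y \<subseteq> X \<times> Y"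
    using xX by (auto intro!: continuous_intros)
  ultimately have "continuous_on Y ?p"
    by (intro continuous_on_fst) (rule continuous_on_compose2)
  \<comment> \<open>One half of \<open>e\<close> pays for the change of gradient from
    \<open>y\<close> to \<open>w\<close>, the other for the linearization of
    \<open>c\<close>.\<close>
  then obtain \<epsilon> where \<epsilon>: "0 < \<epsilon>" "\<forall>w\<in>Y. dist w y < \<epsilon> \<longrightarrow> dist (?p w) (?p y) < e / 2"
    using continuous_on_iff[THEN iffD1, rule_format, OF _ yY half_gt_zero[OF \<open>0 < e\<close>]] by metis
  obtain d where d: "0 < d" "\<forall>z\<in>X. dist z x < d \<longrightarrow> (\<forall>w\<in>minimizers \<phi> z. dist w y < \<epsilon>)"
    using minimizer_close[OF \<phi> xX y \<epsilon>(1)] by auto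
  obtain \<delta> where \<delta>: "0 < \<delta>" "\<forall>z. dist z x < \<delta> \<longrightarrow> z \<in> X \<and>
    (\<forall>y\<in>Y. \<bar>c z y - c x y - (z - x) \<bullet> ?p y\<bar> \<le> e / 2 * norm (z - x))"
    using c_partial_uniform[OF x half_gt_zero[OF \<open>0 < e\<close>]] by auto
  have "norm (cY \<phi> z - cY \<phi> x - (z - x) \<bullet> ?p y) \<le> e * norm (z - x)" if "norm (z - x) < min d \<delta>" for z
  proof -
    have z: "z \<in> X" "dist z x < d" "\<forall>y\<in>Y. \<bar>c z y - c x y - (z - x) \<bullet> ?p y\<bar> \<le> e / 2 * norm (z - x)"
      using that \<delta>(2) by (auto simp: dist_norm)
    obtain w where w: "w \<in> minimizers \<phi> z"
      using minimizers_nonempty[OF \<phi> z(1)] by auto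
    then have w': "w \<in> Y" "cY \<phi> z = c z w - \<phi> w"
      unfolding minimizers_def by auto
    have "dist w y < \<epsilon>"
      using d(2) z(1,2) w by blast
    then have "norm (?p w - ?p y) \<le> e / 2"
      using \<epsilon>(2) w'(1) by (auto simp: dist_norm less_imp_le)
    then have "norm (z - x) * norm (?p w - ?p y) \<le> norm (z - x) * (e / 2)"
      by (rule mult_left_mono) simp
    then have "\<bar>(z - x) \<bullet> (?p w - ?p y)\<bar> \<le> e / 2 * norm (z - x)"
      using Cauchy_Schwarz_ineq2[of "z - x" "?p w - ?p y"] by (simp add: mult.commute)
    then have pw: "\<bar>(z - x) \<bullet> ?p w - (z - x) \<bullet> ?p y\<bar> \<le> e / 2 * norm (z - x)"
      by (simp add: inner_diff_right)
    have half: "e / 2 * norm (z - x) + e / 2 * norm (z - x) = e * norm (z - x)"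
      by simp
    have "\<bar>c z w - c x w - (z - x) \<bullet> ?p w\<bar> \<le> e / 2 * norm (z - x)"
      using z(3) w'(1) by blast
    then have "cY \<phi> x + (z - x) \<bullet> ?p y - e * norm (z - x) \<le> cY \<phi> z"
      using cY_le[OF \<phi> xX w'(1)] w'(2) pw half by linarith
    moreover have "cY \<phi> z \<le> cY \<phi> x + (z - x) \<bullet> ?p y + e / 2 * norm (z - x)"
      by (rule cY_upper[OF \<phi> z(1) yx z(3)])
    moreover have "0 \<le> e * norm (z - x)"
      using \<open>0 < e\<close> by simp
    ultimately show ?thesis
      unfolding real_norm_def by linarith
  qed
  then show "\<exists>d>0. \<forall>z. norm (z - x) < d \<longrightarrow> norm (cY \<phi> z - cY \<phi> x - (z - x) \<bullet> ?p y) \<le> e * norm (z - x)"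
    using d(1) \<delta>(1) by (intro exI[of _ "min d \<delta>"]) auto
qed

end

section \<open>Refraction by a tangential phase\<close>

lemma tensor_mult_vec: "tensor u v *v w = (v \<bullet> w) *\<^sub>R u"
proof -
  have "(\<Sum>j\<in>UNIV. u $ i * v $ j * w $ j) = (\<Sum>j\<in>UNIV. v $ j * w $ j) * u $ i" for i
    unfolding sum_distrib_right by (intro sum.cong) simp_all
  then show ?thesis
    by (simp add: vec_eq_iff tensor_def matrix_vector_mult_def inner_vec_def)
qed

text \<open>Adding \<open>snd v\<close> times \<open>g\<close> removes the unknown multiple of the
  normal, and tangency expresses \<open>snd D\<close> by \<open>fst D\<close>. What remains is the
  identity plus \<open>tensor g g\<close> applied to \<open>fst D\<close>; its inverse is the
  rank-one update in the conclusion.\<close>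

lemma tangential_phase_horizontal:
  fixes g :: "real ^ 'n" and D :: "(real ^ 'n) \<times> real"
  assumes snell: "v = \<mu> *\<^sub>R (- g, 1) + D" and tang: "D \<bullet> (- g, 1) = 0"
  shows "fst D = (mat 1 - (1 / (1 + (norm g)\<^sup>2)) *\<^sub>R tensor g g) *v (fst v + snd v *\<^sub>R g)"
proof -
  have "snd D = g \<bullet> fst D"
    using tang by (simp add: inner_prod_def inner_commute)
  then have w: "fst v + snd v *\<^sub>R g = fst D + (g \<bullet> fst D) *\<^sub>R g"
    by (simp add: snell algebra_simps)
  have pos: "1 + (norm g)\<^sup>2 \<noteq> 0"
    by (metis add.commute power_one sum_power2_eq_zero_iff zero_neq_one)
  have "g \<bullet> (fst D + (g \<bullet> fst D) *\<^sub>R g) = (1 + (norm g)\<^sup>2) * (g \<bullet> fst D)"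
    by (simp add: inner_add_right power2_norm_eq_inner algebra_simps)
  then have "(1 / (1 + (norm g)\<^sup>2)) *\<^sub>R tensor g g *v (fst D + (g \<bullet> fst D) *\<^sub>R g) = (g \<bullet> fst D) *\<^sub>R g"
    using pos by (simp flip: scaleR_matrix_vector_assoc add: tensor_mult_vec)
  then show ?thesis
    unfolding w by (simp add: matrix_vector_mult_diff_rdistrib)
qed

lemma matrix_inv_mult_vec:
  fixes A :: "real ^ 'n ^ 'n"
  assumes "invertible A"
  shows "matrix_inv A *v (A *v w) = w"
proof -
  have "matrix_inv A ** A = mat 1"
    using assms unfolding invertible_def matrix_inv_def by (metis (mono_tags, lifting) someI_ex)
  then show ?thesis
    by (simp add: matrix_vector_mul_assoc)
qed

lemma has_derivative_jacobian:
  fixes \<phi> :: "real ^ 'n \<Rightarrow> real ^ 'm"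
  assumes "\<And>i. GDERIV (\<lambda>x. \<phi> x $ i) x :> J $ i"
  shows "(\<phi> has_derivative (\<lambda>h. J *v h)) (at x)"
proof -
  have "((\<lambda>x. \<phi> x $ i) has_derivative (\<lambda>h. (J *v h) $ i)) (at x)" for i
    using assms[of i] unfolding gderiv_def matrix_vector_mul_component by (simp add: inner_commute)
  then show ?thesis
    unfolding has_derivative_componentwise_within[of \<phi>] by (auto simp: Basis_vec_def inner_axis)
qed

text \<open>Chain rule under the root, whose argument is positive as
  \<open>f (\<phi> x) < \<beta>\<close>; moving \<open>J\<close> across the inner product transposes
  it.\<close>

lemma GDERIV_distance_to_surface:
  fixes \<phi> :: "real ^ 'n \<Rightarrow> real ^ 'm" and y :: "real ^ 'm"
  assumes \<phi>: "(\<phi> has_derivative (\<lambda>h. J *v h)) (at x)" and f: "GDERIV f (\<phi> x) :> Df"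
    and pos: "f (\<phi> x) < \<beta>"
  defines "r \<equiv> sqrt ((\<beta> - f (\<phi> x))\<^sup>2 + (norm (\<phi> x - y))\<^sup>2)"
  shows "GDERIV (\<lambda>x. sqrt ((\<beta> - f (\<phi> x))\<^sup>2 + (norm (\<phi> x - y))\<^sup>2)) x :>
    transpose J *v ((1 / r) *\<^sub>R (\<phi> x - y - (\<beta> - f (\<phi> x)) *\<^sub>R Df))"
proof -
  define q where "q x = (\<beta> - f (\<phi> x))\<^sup>2 + (\<phi> x - y) \<bullet> (\<phi> x - y)" for x
  have q_pos: "0 < q x"
    using pos by (auto simp: q_def intro!: add_pos_nonneg)
  have r: "r = sqrt (q x)"
    by (simp add: r_def q_def power2_norm_eq_inner)
  have f\<phi>: "((\<lambda>x. f (\<phi> x)) has_derivative (\<lambda>h. (J *v h) \<bullet> Df)) (at x)"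
    using has_derivative_compose[OF \<phi> f[unfolded gderiv_def]] .
  have q': "(q has_derivative (\<lambda>h. 2 * ((J *v h) \<bullet> (\<phi> x - y - (\<beta> - f (\<phi> x)) *\<^sub>R Df)))) (at x)"
    unfolding q_def
    by (rule derivative_eq_intros f\<phi> \<phi> refl)+
      (auto simp: fun_eq_iff inner_diff_right inner_diff_left inner_commute algebra_simps power2_eq_square)
  have "(sqrt has_derivative (\<lambda>h. inverse (sqrt (q x)) / 2 * h)) (at (q x))"
    using DERIV_real_sqrt[OF q_pos] unfolding has_field_derivative_def .
  from has_derivative_compose[OF q' this]
  have "((\<lambda>x. sqrt (q x)) has_derivative (\<lambda>h. 2 * ((J *v h) \<bullet> (\<phi> x - y - (\<beta> - f (\<phi> x)) *\<^sub>R Df)) * (inverse r / 2))) (at x)"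
    unfolding r by (simp only: mult.commute)
  moreover have "2 * ((J *v h) \<bullet> w) * (inverse r / 2) = h \<bullet> (transpose J *v ((1 / r) *\<^sub>R w))" for h w
  proof -
    have "h \<bullet> (transpose J *v ((1 / r) *\<^sub>R w)) = ((1 / r) *\<^sub>R w) \<bullet> (J *v h)"
      by (simp only: transpose_matrix_vector inner_commute[of h] dot_lmul_matrix)
    also have "\<dots> = (1 / r) * ((J *v h) \<bullet> w)"
      by (simp add: inner_commute[of w "J *v h"])
    also have "\<dots> = 2 * ((J *v h) \<bullet> w) * (inverse r / 2)"
      by (simp add: field_simps)
    finally show ?thesis ..
  qed
  ultimately show ?thesis
    by (simp add: gderiv_def q_def power2_norm_eq_inner)
qed

lemma GDERIV_unique: "GDERIV g x :> p \<Longrightarrow> GDERIV g x :> q \<Longrightarrow> p = q"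
  unfolding gderiv_def by (drule (1) has_derivative_unique) (metis inner_commute vector_eq_rdot)

section \<open>The potential of an optimal map\<close>

lemma planar_domain_closure: "planar_domain D \<Longrightarrow> D \<subseteq> closure (interior D)"
  unfolding planar_domain_def by (meson closure_mono interior_maximal order_trans)

lemma planar_domain_nonempty: "planar_domain D \<Longrightarrow> D \<noteq> {}"
  unfolding planar_domain_def by auto

section \<open>Lebesgue densities as measures\<close>

abbreviation mass_on :: "'a::euclidean_space set \<Rightarrow> ('a \<Rightarrow> real) \<Rightarrow> 'a measure" where
  "mass_on S \<rho> \<equiv> density (lebesgue_on S) (\<lambda>x. ennreal (\<rho> x))"

locale lebesgue_density =
  fixes S :: "'a::euclidean_space set" and \<rho> :: "'a \<Rightarrow> real"
  assumes S_sets: "S \<in> sets lebesgue" and nonneg: "\<And>x. x \<in> S \<Longrightarrow> 0 \<le> \<rho> x"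
    and integrable: "set_integrable lebesgue S \<rho>"
begin

lemma integrable_lebesgue_on: "integrable (lebesgue_on S) \<rho>"
  using integrable S_sets by (simp add: integrable_restrict_space set_integrable_def)

lemma measurable_density: "\<rho> \<in> borel_measurable (lebesgue_on S)"
  using integrable_lebesgue_on by auto

lemma AE_nonneg: "AE x in lebesgue_on S. 0 \<le> \<rho> x"
  using nonneg by (intro AE_I2) simp

lemma integral_mass_on:
  fixes g :: "'a \<Rightarrow> real"
  assumes "g \<in> borel_measurable (lebesgue_on S)"
  shows "integral\<^sup>L (mass_on S \<rho>) g = (LINT x:S|lebesgue. g x * \<rho> x)"
  using S_sets
  by (simp add: integral_density[OF assms measurable_density AE_nonneg] integral_restrict_space
      set_lebesgue_integral_def mult.commute)

lemma measure_mass_on: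
  assumes "A \<in> sets lebesgue" "A \<subseteq> S"
  shows "measure (mass_on S \<rho>) A = (LINT x:A|lebesgue. \<rho> x)"
proof -
  have A: "A \<in> sets (lebesgue_on S)"
    using assms S_sets by (simp add: sets_restrict_space_iff)
  then have "indicat_real A \<in> borel_measurable (lebesgue_on S)"
    by simp
  then have "integral\<^sup>L (mass_on S \<rho>) (indicat_real A) = (LINT x:S|lebesgue. indicat_real A x * \<rho> x)"
    by (rule integral_mass_on)
  also have "\<dots> = (LINT x:A|lebesgue. \<rho> x)"
    unfolding set_lebesgue_integral_def using assms(2)
    by (intro Bochner_Integration.integral_cong) (auto simp: indicator_def)
  finally show ?thesis
    using assms(2) by (simp add: Int_absorb2)
qed

lemma finite_mass_on: "finite_measure (mass_on S \<rho>)"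
proof (rule finite_measureI)
  have "emeasure (mass_on S \<rho>) (space (mass_on S \<rho>)) = (\<integral>\<^sup>+x. ennreal (\<rho> x) \<partial>lebesgue_on S)"
    using measurable_density by (subst emeasure_density) (auto intro!: nn_integral_cong)
  also have "\<dots> < \<infinity>"
    using integrable_lebesgue_on AE_nonneg by (simp add: nn_integral_eq_integral)
  finally show "emeasure (mass_on S \<rho>) (space (mass_on S \<rho>)) \<noteq> \<infinity>"
    by simp
qed

lemma sets_mass_on: "sets (restrict_space borel S) \<subseteq> sets (mass_on S \<rho>)"
proof -
  have "sets borel \<subseteq> sets (lebesgue :: 'a measure)"
    using sets_completionI_sets[of _ lborel] by (intro subsetI) simp
  then show ?thesis
    unfolding sets_density sets_restrict_space by (rule image_mono)
qed

lemma AE_mass_on: "(AE x in lebesgue_on S. P x) \<Longrightarrow> AE x in mass_on S \<rho>. P x"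
  using measurable_density by (subst AE_density) (auto elim: eventually_mono)

text \<open>The mass measure sees only points of positive density; positivity almost everywhere
  turns its null sets into Lebesgue null sets.\<close>

lemma AE_lebesgue_on:
  assumes "AE x in mass_on S \<rho>. P x" "AE x in lebesgue_on S. 0 < \<rho> x"
  shows "AE x in lebesgue_on S. P x"
proof -
  have "AE x in lebesgue_on S. 0 < ennreal (\<rho> x) \<longrightarrow> P x"
    using assms(1) measurable_density by (subst (asm) AE_density) auto
  then show ?thesis
    using assms(2) by eventually_elim simp
qed

end

text \<open>\<open>transport_map\<close> tests Borel subsets of \<open>Y\<close>, whereas equality
  of the push-forwards tests all Borel sets. Both measures are concentrated on \<open>Y\<close>, so
  intersecting with \<open>Y\<close> loses nothing.\<close>

lemma push_forward_iff_transport_map: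
  fixes X Y :: "plane set"
  assumes X: "lebesgue_density X \<rho>\<^sub>0" and Y: "lebesgue_density Y \<rho>\<^sub>1" "closed Y"
    and s: "s \<in> borel_measurable (lebesgue_on X)" "AE x in lebesgue_on X. s x \<in> Y"
  shows "transport_map X Y \<rho>\<^sub>0 \<rho>\<^sub>1 s \<longleftrightarrow> distr (mass_on X \<rho>\<^sub>0) borel s = distr (mass_on Y \<rho>\<^sub>1) borel (\<lambda>y. y)"
    (is "_ \<longleftrightarrow> ?P = ?Q")
proof -
  interpret X: lebesgue_density X \<rho>\<^sub>0 by fact
  interpret Y: lebesgue_density Y \<rho>\<^sub>1 by fact
  interpret MX: finite_measure "mass_on X \<rho>\<^sub>0" by (rule X.finite_mass_on)
  interpret MY: finite_measure "mass_on Y \<rho>\<^sub>1" by (rule Y.finite_mass_on)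
  have s': "s \<in> borel_measurable (mass_on X \<rho>\<^sub>0)"
    using s(1) by simp
  have id: "(\<lambda>y. y) \<in> borel_measurable (mass_on Y \<rho>\<^sub>1)"
    by (intro borel_measurable_subalgebra[OF Y.sets_mass_on]) (auto simp: space_restrict_space intro: borel_measurable_continuous_on_restrict)
  interpret P: finite_measure ?P by (rule MX.finite_measure_distr[OF s'])
  interpret Q: finite_measure ?Q by (rule MY.finite_measure_distr[OF id])
  have vimage: "{x \<in> X. s x \<in> E} \<in> sets lebesgue" if "E \<in> sets borel" for E
    using measurable_sets[OF s(1) that] X.S_sets
    by (simp add: sets_restrict_space_iff vimage_def Int_def conj_commute)
  have P: "measure ?P E = (LINT x:{x\<in>X. s x \<in> E}|lebesgue. \<rho>\<^sub>0 x)" if "E \<in> sets borel" for E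
    using X.measure_mass_on[OF vimage[OF that]] measure_distr[OF s' that]
    by (simp add: vimage_def Int_def conj_commute)
  have Q: "measure ?Q E = (LINT y:E|lebesgue. \<rho>\<^sub>1 y)" if "E \<in> sets borel" "E \<subseteq> Y" for E
    using Y.measure_mass_on[of E] measure_distr[OF id that(1)] that by (simp add: Int_absorb2)
  have restrict: "measure ?P E = measure ?P (E \<inter> Y)" "measure ?Q E = measure ?Q (E \<inter> Y)" if "E \<in> sets borel" for E
  proof -
    have E: "E \<inter> Y \<in> sets borel"
      using that Y(2) by auto
    \<comment> \<open>Measurability of the set where \<open>E\<close> and
      \<open>E \<inter> Y\<close> agree lets almost-everywhere statements pass through
      \<open>distr\<close>.\<close>
    have "{y. y \<in> E \<longleftrightarrow> y \<in> E \<inter> Y} = E \<inter> Y \<union> - E"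
      by auto
    then have meas: "{y \<in> space borel. y \<in> E \<longleftrightarrow> y \<in> E \<inter> Y} \<in> sets borel"
      using that E by simp
    have "AE y in ?P. y \<in> E \<longleftrightarrow> y \<in> E \<inter> Y"
      unfolding AE_distr_iff[OF s' meas] using X.AE_mass_on[OF s(2)] by eventually_elim simp
    then show "measure ?P E = measure ?P (E \<inter> Y)"
      using that E by (intro P.finite_measure_eq_AE) auto
    have "AE y in ?Q. y \<in> E \<longleftrightarrow> y \<in> E \<inter> Y"
      unfolding AE_distr_iff[OF id meas] by (intro AE_I2) simp
    then show "measure ?Q E = measure ?Q (E \<inter> Y)"
      using that E by (intro Q.finite_measure_eq_AE) auto
  qed
  show ?thesis
  proof
    assume "transport_map X Y \<rho>\<^sub>0 \<rho>\<^sub>1 s"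
    then have eq: "measure ?P E = measure ?Q E" if "E \<in> sets borel" "E \<subseteq> Y" for E
      using P Q that unfolding transport_map_def by auto
    show "?P = ?Q"
    proof (rule measure_eqI)
      fix E assume "E \<in> sets ?P"
      then have E: "E \<in> sets borel" by simp
      then have "measure ?P (E \<inter> Y) = measure ?Q (E \<inter> Y)"
        using Y(2) by (intro eq) auto
      then show "emeasure ?P E = emeasure ?Q E"
        using restrict[OF E] by (simp add: P.emeasure_eq_measure Q.emeasure_eq_measure)
    qed simp
  next
    assume eq: "?P = ?Q"
    have "(LINT x:{x\<in>X. s x \<in> E}|lebesgue. \<rho>\<^sub>0 x) = (LINT y:E|lebesgue. \<rho>\<^sub>1 y)" if "E \<in> sets borel" "E \<subseteq> Y" for E
      using P[OF that(1)] Q[OF that] arg_cong[OF eq, of "\<lambda>R. measure R E"] by linarith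
    then show "transport_map X Y \<rho>\<^sub>0 \<rho>\<^sub>1 s"
      using s unfolding transport_map_def by blast
  qed
qed

text \<open>Uniqueness of optimal maps comes out rather than goes in: any \<open>T\<close> of
  minimal cost must pick the almost everywhere unique minimizer. The hypothesis \<open>cT\<close>
  takes care of the null set on which \<open>T\<close> may leave \<open>Y\<close>, where continuity
  of \<open>c\<close> gives no control.\<close>

lemma optimal_map_potential:
  fixes c :: "plane \<Rightarrow> plane \<Rightarrow> real"
  assumes cost: "twisted_cost c X Y L Dc"
    and X: "lebesgue_density X \<rho>\<^sub>0" and Y: "lebesgue_density Y \<rho>\<^sub>1"
    and mass: "(LINT x:X|lebesgue. \<rho>\<^sub>0 x) = (LINT y:Y|lebesgue. \<rho>\<^sub>1 y)"
    and frontier: "negligible (frontier X)" and pos: "AE x in lebesgue_on X. 0 < \<rho>\<^sub>0 x"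
    and T: "optimal_map c X Y \<rho>\<^sub>0 \<rho>\<^sub>1 T"
    and cT: "(\<lambda>x. c x (T x)) \<in> borel_measurable (lebesgue_on X)"
  shows "\<exists>\<psi>. c_concave c X Y \<psi> \<and> (AE x in lebesgue_on X. c_superdiff c X Y \<psi> x = {T x}) \<and>
    (AE x in lebesgue_on X. GDERIV \<psi> x :> fst (Dc (x, T x)))"
proof -
  interpret twisted_cost c X Y L Dc by fact
  interpret X: lebesgue_density X \<rho>\<^sub>0 by fact
  interpret Y: lebesgue_density Y \<rho>\<^sub>1 by fact
  let ?M = "mass_on X \<rho>\<^sub>0" and ?N = "mass_on Y \<rho>\<^sub>1"
  have "transport_problem c X Y L ?M ?N"
    unfolding transport_problem_def transport_problem_axioms_def
    using compact_cost_axioms X.finite_mass_on Y.finite_mass_on X.sets_mass_on Y.sets_mass_on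
      X.measure_mass_on[OF X.S_sets] Y.measure_mass_on[OF Y.S_sets] mass
    by simp
  then interpret transport_problem c X Y L ?M ?N .
  obtain \<phi> where \<phi>: "continuous_on Y \<phi>" and conj: "cX (cY \<phi>) = \<phi>"
    and max: "\<And>h. continuous_on Y h \<Longrightarrow> dual h \<le> dual \<phi>"
    using dual_attained by metis
  obtain y0 where y0: "y0 \<in> Y" using Y_nonempty by blast
  have T_transport: "transport_map X Y \<rho>\<^sub>0 \<rho>\<^sub>1 T"
    and T_min: "\<And>s. transport_map X Y \<rho>\<^sub>0 \<rho>\<^sub>1 s \<Longrightarrow>
      (LINT x:X|lebesgue. c x (T x) * \<rho>\<^sub>0 x) \<le> (LINT x:X|lebesgue. c x (s x) * \<rho>\<^sub>0 x)"
    using T unfolding optimal_map_def by auto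
  then have T_meas: "T \<in> borel_measurable (lebesgue_on X)" and T_Y: "AE x in lebesgue_on X. T x \<in> Y"
    unfolding transport_map_def by auto
  have closed_Y: "closed Y" using compact_Y by (rule compact_imp_closed)
  note push_iff = push_forward_iff_transport_map[OF X Y closed_Y]

  \<comment> \<open>The rest of \<open>X\<close> is null: it consists of boundary points and of
    interior points with several minimizers.\<close>
  define G where "G = {x \<in> interior X. \<exists>y. minimizers \<phi> x = {y}}"
  \<comment> \<open>The default \<open>y0\<close> keeps the values of \<open>s\<close> in
    \<open>Y\<close> everywhere.\<close>
  define s where "s x = (if x \<in> G then the_elem (minimizers \<phi> x) else y0)" for x
  have G_X: "G \<subseteq> X"
    unfolding G_def using interior_subset by blast
  have "X - G \<subseteq> frontier X \<union> {x \<in> interior X. \<nexists>y. minimizers \<phi> x = {y}}"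
    using compact_imp_closed[OF compact_X] by (auto simp: G_def frontier_def)
  then have "negligible (X - G)"
    using negligible_Un[OF frontier negligible_minimizers_nonunique[OF \<phi>]] negligible_subset by blast
  then have null: "X - G \<in> null_sets lebesgue"
    by (simp add: negligible_iff_null_sets)
  then have "AE x in lebesgue. x \<notin> X - G"
    by (rule AE_not_in)
  then have AE_G: "AE x in lebesgue_on X. x \<in> G"
    using X.S_sets by (subst AE_restrict_space_iff) (auto elim!: eventually_mono)
  have G_sets: "G \<in> sets lebesgue"
  proof -
    have "G = X - (X - G)"
      using G_X by blast
    also have "\<dots> \<in> sets lebesgue"
      by (rule sets.Diff[OF X.S_sets null_setsD2[OF null]])
    finally show ?thesis .
  qed
  have s_G: "minimizers \<phi> x = {s x}" if "x \<in> G" for x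
  proof -
    have "\<exists>y. minimizers \<phi> x = {y}"
      using that by (simp add: G_def)
    then obtain y where "minimizers \<phi> x = {y}" ..
    then show ?thesis
      using that by (simp add: s_def)
  qed
  have s_Y: "s x \<in> Y" for x
  proof (cases "x \<in> G")
    case True
    then have "s x \<in> minimizers \<phi> x" using s_G by simp
    then show ?thesis unfolding minimizers_def by simp
  qed (simp add: s_def y0)
  have s_meas: "s \<in> borel_measurable (lebesgue_on X)"
  proof -
    \<comment> \<open>\<open>s\<close> is continuous on the measurable set \<open>G\<close> and
      constant off it, hence measurable.\<close>
    have "continuous_on G s"
      using \<phi> G_X s_G by (rule continuous_on_unique_minimizer)
    then have "s \<in> borel_measurable (lebesgue_on G)"
      using G_sets by (rule continuous_imp_measurable_on_sets_lebesgue)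
    then have "(\<lambda>x. if x \<in> G then s x else y0) \<in> borel_measurable lebesgue"
      using G_sets by (subst measurable_If_restrict_space_iff) auto
    moreover have "(\<lambda>x. if x \<in> G then s x else y0) = s"
      by (simp add: s_def fun_eq_iff)
    ultimately have "s \<in> borel_measurable lebesgue"
      by simp
    then show ?thesis
      by (rule measurable_restrict_space1)
  qed
  have s_AE: "AE x in ?M. minimizers \<phi> x = {s x}"
    using X.AE_mass_on[OF AE_G] by eventually_elim (rule s_G)
  have s_push: "distr ?M borel s = distr ?N borel (\<lambda>y. y)"
    using s_meas s_AE by (intro optimal_push_forward[OF \<phi> max]) simp_all
  have s_transport: "transport_map X Y \<rho>\<^sub>0 \<rho>\<^sub>1 s"
    using push_iff[OF s_meas] s_push s_Y by simp

  \<comment> \<open>The duality lemmas ask for values in \<open>Y\<close> at every point, so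
    \<open>T\<close> is corrected on the null set where it leaves \<open>Y\<close>.\<close>
  define T' where "T' x = (if T x \<in> Y then T x else y0)" for x
  have T'_Y: "T' x \<in> Y" for x by (simp add: T'_def y0)
  have T'_T: "AE x in ?M. T' x = T x"
    using X.AE_mass_on[OF T_Y] by eventually_elim (simp add: T'_def)
  have "Y \<in> sets borel" using closed_Y by simp
  then have "(\<lambda>y. if y \<in> Y then y else y0) \<in> borel_measurable borel"
    by (intro measurable_If_set) auto
  then have T'_meas: "T' \<in> borel_measurable (lebesgue_on X)"
    unfolding T'_def by (rule measurable_compose[OF T_meas])
  have "distr ?M borel T' = distr ?M borel T"
    using T'_T T'_meas T_meas by (intro distr_cong_AE) auto
  then have T'_push: "distr ?M borel T' = distr ?N borel (\<lambda>y. y)"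
    using push_iff[OF T_meas T_Y] T_transport by simp
  have s_cost: "(\<lambda>x. c x (s x)) \<in> borel_measurable (lebesgue_on X)"
    using integrable_cost[of s] s_meas s_Y by auto
  have T'_cost: "(\<lambda>x. c x (T' x)) \<in> borel_measurable (lebesgue_on X)"
    using integrable_cost[of T'] T'_meas T'_Y by auto
  have "(\<integral>x. c x (T' x) \<partial>?M) = (\<integral>x. c x (T x) \<partial>?M)"
    using T'_T T'_cost cT by (intro integral_cong_AE) (auto elim: eventually_mono)
  also have "\<dots> \<le> (\<integral>x. c x (s x) \<partial>?M)"
    using T_min[OF s_transport] by (simp add: X.integral_mass_on[OF cT] X.integral_mass_on[OF s_cost])
  finally have le: "(\<integral>x. c x (T' x) \<partial>?M) \<le> (\<integral>x. c x (s x) \<partial>?M)" .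
  have "AE x in ?M. s x \<in> minimizers \<phi> x"
    using s_AE by eventually_elim simp
  then have "AE x in ?M. T' x \<in> minimizers \<phi> x"
    using s_meas s_Y s_push T'_meas T'_Y T'_push le
    by (intro optimal_in_minimizers[OF \<phi>, of s T']) simp_all
  then have "AE x in ?M. T x = s x"
    using T'_T s_AE
  proof eventually_elim
    case (elim x)
    then show ?case by simp
  qed
  then have "AE x in lebesgue_on X. T x = s x"
    using pos by (rule X.AE_lebesgue_on)
  then have T_G: "AE x in lebesgue_on X. x \<in> G \<and> minimizers \<phi> x = {T x}"
    using AE_G by eventually_elim (simp add: s_G)

  show ?thesis
  proof (intro exI[of _ "cY \<phi>"] conjI)
    show "c_concave c X Y (cY \<phi>)"
      unfolding c_concave_def
    proof
      fix x assume x: "x \<in> X"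
      obtain y where y: "y \<in> Y" "cY \<phi> x = c x y - \<phi> y"
        by (rule cY_attained[OF \<phi> x])
      have "\<forall>x\<in>X. cY \<phi> x \<le> c x y - \<phi> y"
        using cY_le[OF \<phi> _ y(1)] by blast
      with y show "\<exists>m\<^sub>0\<in>Y. \<exists>b. (\<forall>x\<in>X. cY \<phi> x \<le> c x m\<^sub>0 - b) \<and> cY \<phi> x = c x m\<^sub>0 - b"
        by blast
    qed
    have superdiff: "c_superdiff c X Y (cY \<phi>) x = minimizers \<phi> x" for x
      unfolding c_superdiff_def conj minimizers_def eq_diff_eq ..
    show "AE x in lebesgue_on X. c_superdiff c X Y (cY \<phi>) x = {T x}"
      using T_G by eventually_elim (simp add: superdiff)
    show "AE x in lebesgue_on X. GDERIV (cY \<phi>) x :> fst (Dc (x, T x))"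
      using T_G
    proof eventually_elim
      case (elim x)
      then have "x \<in> interior X"
        by (simp add: G_def)
      then show ?case
        using elim by (intro GDERIV_cY[OF \<phi>]) simp_all
    qed
  qed
qed

section \<open>From the potential to the phase\<close>

theorem theorem3p1:
  fixes \<Omega>\<^sub>0 \<Omega>\<^sub>1 \<Omega>\<^sub>0' :: "plane set"
    and e :: "plane \<Rightarrow> space"
    and \<phi> :: "plane \<Rightarrow> plane" and J :: "plane \<Rightarrow> real ^ 2 ^ 2"
    and f :: "plane \<Rightarrow> real" and Df :: "plane \<Rightarrow> plane"
    and \<beta> n\<^sub>1 n\<^sub>2 :: real
    and \<rho>\<^sub>0 \<rho>\<^sub>1 :: "plane \<Rightarrow> real"
    and c :: "plane \<Rightarrow> plane \<Rightarrow> real" and Dc :: "plane \<times> plane \<Rightarrow> plane \<times> plane"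
    and T :: "plane \<Rightarrow> plane"
  assumes domains: "planar_domain \<Omega>\<^sub>0" "planar_domain \<Omega>\<^sub>1" "planar_domain \<Omega>\<^sub>0'"
    and unit: "\<forall>x\<in>\<Omega>\<^sub>0. norm (e x) = 1"
    and upward: "\<forall>x\<in>\<Omega>\<^sub>0. 0 < snd (e x)"
    and above_source: "\<forall>p\<in>\<Omega>\<^sub>0'. 0 < f p"
    and rays: "\<forall>x\<in>\<Omega>\<^sub>0. {(x, 0) + t *\<^sub>R e x | t. 0 < t} \<inter> surface \<Omega>\<^sub>0' f = {(\<phi> x, f (\<phi> x))}"
    and \<phi>_bij: "bij_betw \<phi> \<Omega>\<^sub>0 \<Omega>\<^sub>0'"
    and \<phi>_C2: "C2_with_jacobian \<phi> J \<Omega>\<^sub>0"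
    and J_nonsingular: "\<forall>x\<in>\<Omega>\<^sub>0. invertible (J x)"
    and f_C1: "C1_with_gradient f Df \<Omega>\<^sub>0'"
    and below_target: "\<exists>\<delta>>0. \<forall>p\<in>\<Omega>\<^sub>0'. f p + \<delta> \<le> \<beta>"
    and indices: "0 < n\<^sub>1" "0 < n\<^sub>2"
    and densities_nonneg: "\<forall>x\<in>\<Omega>\<^sub>0. 0 \<le> \<rho>\<^sub>0 x" "\<forall>y\<in>\<Omega>\<^sub>1. 0 \<le> \<rho>\<^sub>1 y"
    and densities_integrable: "set_integrable lebesgue \<Omega>\<^sub>0 \<rho>\<^sub>0" "set_integrable lebesgue \<Omega>\<^sub>1 \<rho>\<^sub>1"
    and cost: "\<forall>x y. c x y = sqrt ((\<beta> - f (\<phi> x))\<^sup>2 + (norm (\<phi> x - y))\<^sup>2)"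
    and compact: "compact \<Omega>\<^sub>0" "compact \<Omega>\<^sub>1"
    and boundary_null: "emeasure lebesgue (frontier \<Omega>\<^sub>0) = 0"
    and c_C1: "C1_with_gradient (\<lambda>(x, y). c x y) Dc (\<Omega>\<^sub>0 \<times> \<Omega>\<^sub>1)"
    and c_Lipschitz: "\<exists>L. L-lipschitz_on (\<Omega>\<^sub>0 \<times> \<Omega>\<^sub>1) (\<lambda>(x, y). c x y)"
    and c_twist: "\<forall>x\<in>\<Omega>\<^sub>0. inj_on (\<lambda>y. fst (Dc (x, y))) \<Omega>\<^sub>1"
    and mass_balance: "(LINT x:\<Omega>\<^sub>0|lebesgue. \<rho>\<^sub>0 x) = (LINT y:\<Omega>\<^sub>1|lebesgue. \<rho>\<^sub>1 y)"
    and \<rho>\<^sub>0_pos: "AE x in lebesgue_on \<Omega>\<^sub>0. 0 < \<rho>\<^sub>0 x"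
    and T_optimal: "optimal_map c \<Omega>\<^sub>0 \<Omega>\<^sub>1 \<rho>\<^sub>0 \<rho>\<^sub>1 T"
  shows "\<exists>\<psi> D\<psi>.
      c_concave c \<Omega>\<^sub>0 \<Omega>\<^sub>1 \<psi> \<and>
      (AE x in lebesgue_on \<Omega>\<^sub>0. c_superdiff c \<Omega>\<^sub>0 \<Omega>\<^sub>1 \<psi> x = {T x}) \<and>
      (AE x in lebesgue_on \<Omega>\<^sub>0. GDERIV \<psi> x :> D\<psi> x \<and> D\<psi> x = fst (Dc (x, T x))) \<and>
      (\<forall>\<Phi> D\<Phi>.
         phase (surface \<Omega>\<^sub>0' f) \<Phi> D\<Phi> \<longrightarrow>
         tangential \<Omega>\<^sub>0' f Df D\<Phi> \<longrightarrow>
         (AE x in lebesgue_on \<Omega>\<^sub>0. refracts n\<^sub>1 n\<^sub>2 \<beta> f Df D\<Phi> (e x) (\<phi> x) (T x)) \<longrightarrow>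
         (AE x in lebesgue_on \<Omega>\<^sub>0.
            fst (D\<Phi> (\<phi> x, f (\<phi> x))) =
              (mat 1 - (1 / (1 + (norm (Df (\<phi> x)))\<^sup>2)) *\<^sub>R tensor (Df (\<phi> x)) (Df (\<phi> x))) *v
              (n\<^sub>2 *\<^sub>R (matrix_inv (transpose (J x)) *v D\<psi> x)
                + (n\<^sub>1 * snd (e x)) *\<^sub>R Df (\<phi> x)
                + n\<^sub>1 *\<^sub>R fst (e x))))"
proof -
  obtain L where L: "L-lipschitz_on (\<Omega>\<^sub>0 \<times> \<Omega>\<^sub>1) (\<lambda>(x, y). c x y)"
    using c_Lipschitz by blast
  have tc: "twisted_cost c \<Omega>\<^sub>0 \<Omega>\<^sub>1 L Dc"
    using compact L c_C1 c_twist planar_domain_closure[OF domains(2)]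
      planar_domain_nonempty[OF domains(1)] planar_domain_nonempty[OF domains(2)]
    by unfold_locales auto
  have \<Omega>\<^sub>0_lebesgue: "\<Omega>\<^sub>0 \<in> sets lebesgue" and \<Omega>\<^sub>1_lebesgue: "\<Omega>\<^sub>1 \<in> sets lebesgue"
    using compact by (simp_all add: lmeasurable_compact fmeasurableD)
  have densities: "lebesgue_density \<Omega>\<^sub>0 \<rho>\<^sub>0" "lebesgue_density \<Omega>\<^sub>1 \<rho>\<^sub>1"
    using \<Omega>\<^sub>0_lebesgue \<Omega>\<^sub>1_lebesgue densities_nonneg densities_integrable
    unfolding lebesgue_density_def by blast+
  have frontier: "negligible (frontier \<Omega>\<^sub>0)"
    unfolding negligible_iff_null_sets using boundary_null frontier_closed[of \<Omega>\<^sub>0]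
    by (intro null_setsI) auto
  have \<phi>_continuous: "continuous_on \<Omega>\<^sub>0 \<phi>"
  proof -
    have "continuous_on \<Omega>\<^sub>0 (\<lambda>x. \<phi> x $ i)" for i
      using \<phi>_C2 unfolding C2_with_jacobian_def C1_with_gradient_def by blast
    then have "continuous_on \<Omega>\<^sub>0 (\<lambda>x. \<chi> i. \<phi> x $ i)"
      by (rule continuous_on_vec_lambda)
    then show ?thesis by simp
  qed
  have \<phi>_image: "\<phi> ` \<Omega>\<^sub>0 = \<Omega>\<^sub>0'" and \<phi>_inj: "inj_on \<phi> \<Omega>\<^sub>0"
    using \<phi>_bij unfolding bij_betw_def by auto
  have f\<phi>_continuous: "continuous_on \<Omega>\<^sub>0 (\<lambda>x. f (\<phi> x))"
  proof -
    have "continuous_on \<Omega>\<^sub>0' f"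
      using f_C1 unfolding C1_with_gradient_def by (rule conjunct1)
    then show ?thesis
      using \<phi>_continuous by (rule continuous_on_compose2) (simp add: \<phi>_image)
  qed
  have T_meas: "T \<in> borel_measurable (lebesgue_on \<Omega>\<^sub>0)" and T_target: "AE x in lebesgue_on \<Omega>\<^sub>0. T x \<in> \<Omega>\<^sub>1"
    using T_optimal unfolding optimal_map_def transport_map_def by auto
  \<comment> \<open>The explicit formula defines \<open>c\<close> on the whole plane, so values of
    \<open>T\<close> outside \<open>\<Omega>\<^sub>1\<close> do not spoil measurability.\<close>
  have cost_T: "(\<lambda>x. c x (T x)) \<in> borel_measurable (lebesgue_on \<Omega>\<^sub>0)"
  proof -
    have [measurable]: "\<phi> \<in> borel_measurable (lebesgue_on \<Omega>\<^sub>0)"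
      "(\<lambda>x. f (\<phi> x)) \<in> borel_measurable (lebesgue_on \<Omega>\<^sub>0)" "T \<in> borel_measurable (lebesgue_on \<Omega>\<^sub>0)"
      by (fact continuous_imp_measurable_on_sets_lebesgue[OF \<phi>_continuous \<Omega>\<^sub>0_lebesgue]
          continuous_imp_measurable_on_sets_lebesgue[OF f\<phi>_continuous \<Omega>\<^sub>0_lebesgue] T_meas)+
    show ?thesis
      unfolding cost[rule_format] by measurable
  qed
  obtain \<psi> where concave: "c_concave c \<Omega>\<^sub>0 \<Omega>\<^sub>1 \<psi>"
    and superdiff: "AE x in lebesgue_on \<Omega>\<^sub>0. c_superdiff c \<Omega>\<^sub>0 \<Omega>\<^sub>1 \<psi> x = {T x}"
    and grad: "AE x in lebesgue_on \<Omega>\<^sub>0. GDERIV \<psi> x :> fst (Dc (x, T x))"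
    using optimal_map_potential[OF tc densities mass_balance frontier \<rho>\<^sub>0_pos T_optimal cost_T] by auto

  \<comment> \<open>Minus the sum of the horizontal part of the refracted direction and its vertical
    part times the gradient of \<open>f\<close>.\<close>
  define w where "w x = (1 / c x (T x)) *\<^sub>R (\<phi> x - T x - (\<beta> - f (\<phi> x)) *\<^sub>R Df (\<phi> x))" for x
  have Dc_eq: "fst (Dc (x, T x)) = transpose (J x) *v w x" if x: "x \<in> interior \<Omega>\<^sub>0" and Tx: "T x \<in> \<Omega>\<^sub>1" for x
  proof -
    have "x \<in> \<Omega>\<^sub>0"
      using x interior_subset by auto
    \<comment> \<open>Invariance of domain puts \<open>\<phi> x\<close> in the interior of
      \<open>\<Omega>\<^sub>0'\<close>, where \<open>Df\<close> is a genuine gradient of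
      \<open>f\<close>.\<close>
    have "open (\<phi> ` interior \<Omega>\<^sub>0)"
      using \<phi>_continuous \<phi>_inj interior_subset
      by (intro invariance_of_domain) (auto intro: continuous_on_subset inj_on_subset)
    moreover have "\<phi> ` interior \<Omega>\<^sub>0 \<subseteq> \<Omega>\<^sub>0'"
      using \<phi>_image interior_subset by blast
    ultimately have "\<phi> x \<in> interior \<Omega>\<^sub>0'"
      using x by (meson image_eqI interior_maximal subsetD)
    then have Df: "GDERIV f (\<phi> x) :> Df (\<phi> x)"
      using f_C1 unfolding C1_with_gradient_def by blast
    have J: "(\<phi> has_derivative (\<lambda>h. J x *v h)) (at x)"
      using \<phi>_C2 x unfolding C2_with_jacobian_def C1_with_gradient_def
      by (intro has_derivative_jacobian) blast
    have "\<phi> x \<in> \<Omega>\<^sub>0'"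
      using \<phi>_image \<open>x \<in> \<Omega>\<^sub>0\<close> by blast
    then have "f (\<phi> x) < \<beta>"
      using below_target by fastforce
    \<comment> \<open>The partial gradient is computed twice, by the chain rule and as the first
      component of \<open>Dc\<close>, which is legitimate even if \<open>T x\<close> lies on the
      boundary of \<open>\<Omega>\<^sub>1\<close>.\<close>
    from GDERIV_distance_to_surface[OF J Df this, of "T x"]
    have "GDERIV (\<lambda>x'. c x' (T x)) x :> transpose (J x) *v w x"
      unfolding w_def cost[rule_format] .
    moreover have "GDERIV (\<lambda>x'. c x' (T x)) x :> fst (Dc (x, T x))"
      using C1_with_gradient_partial[OF c_C1 compact planar_domain_closure[OF domains(2)] x Tx] by simp
    ultimately show ?thesis
      by (metis GDERIV_unique)
  qed
  have interior: "AE x in lebesgue_on \<Omega>\<^sub>0. x \<in> interior \<Omega>\<^sub>0"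
  proof -
    have "AE x in lebesgue. x \<notin> frontier \<Omega>\<^sub>0"
      using frontier by (intro AE_not_in) (simp add: negligible_iff_null_sets)
    then have "AE x in lebesgue. x \<in> \<Omega>\<^sub>0 \<longrightarrow> x \<in> interior \<Omega>\<^sub>0"
      by eventually_elim (use closure_subset in \<open>auto simp: frontier_def\<close>)
    then show ?thesis
      using \<Omega>\<^sub>0_lebesgue by (simp add: AE_restrict_space_iff)
  qed
  have phase_formula: "fst (D\<Phi> (\<phi> x, f (\<phi> x))) =
      (mat 1 - (1 / (1 + (norm (Df (\<phi> x)))\<^sup>2)) *\<^sub>R tensor (Df (\<phi> x)) (Df (\<phi> x))) *v
      (n\<^sub>2 *\<^sub>R (matrix_inv (transpose (J x)) *v fst (Dc (x, T x)))
        + (n\<^sub>1 * snd (e x)) *\<^sub>R Df (\<phi> x) + n\<^sub>1 *\<^sub>R fst (e x))"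
    if tang: "tangential \<Omega>\<^sub>0' f Df D\<Phi>" and refr: "refracts n\<^sub>1 n\<^sub>2 \<beta> f Df D\<Phi> (e x) (\<phi> x) (T x)"
      and x: "x \<in> interior \<Omega>\<^sub>0" and Tx: "T x \<in> \<Omega>\<^sub>1" for D\<Phi> x
  proof -
    have "x \<in> \<Omega>\<^sub>0"
      using x interior_subset by auto
    then have "\<phi> x \<in> \<Omega>\<^sub>0'"
      using \<phi>_image by blast
    then have tang': "D\<Phi> (\<phi> x, f (\<phi> x)) \<bullet> (- Df (\<phi> x), 1) = 0"
      using tang unfolding tangential_def by blast
    \<comment> \<open>The normalizing root in Snell's law is the cost itself.\<close>
    have c_eq: "sqrt ((norm (T x - \<phi> x))\<^sup>2 + (\<beta> - f (\<phi> x))\<^sup>2) = c x (T x)"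
      by (simp add: cost norm_minus_commute add.commute)
    define v where "v = n\<^sub>1 *\<^sub>R e x - n\<^sub>2 *\<^sub>R ((1 / c x (T x)) *\<^sub>R (T x - \<phi> x, \<beta> - f (\<phi> x)))"
    obtain \<mu> where "v = \<mu> *\<^sub>R (- Df (\<phi> x), 1) + D\<Phi> (\<phi> x, f (\<phi> x))"
      using refr unfolding refracts_def c_eq v_def by blast
    note formula = tangential_phase_horizontal[OF this tang']
    have "matrix_inv (transpose (J x)) *v fst (Dc (x, T x)) = w x"
      unfolding Dc_eq[OF x Tx]
      using J_nonsingular \<open>x \<in> \<Omega>\<^sub>0\<close> by (intro matrix_inv_mult_vec transpose_invertible) blast
    \<comment> \<open>The terms with \<open>n\<^sub>2\<close> collect to \<open>w x\<close>; those
      with \<open>n\<^sub>1\<close> come from the incident ray.\<close>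
    moreover have "fst v + snd v *\<^sub>R Df (\<phi> x) = n\<^sub>2 *\<^sub>R w x + (n\<^sub>1 * snd (e x)) *\<^sub>R Df (\<phi> x) + n\<^sub>1 *\<^sub>R fst (e x)"
      by (simp add: v_def w_def algebra_simps diff_divide_distrib)
    ultimately show ?thesis
      using formula by simp
  qed
  show ?thesis
  proof (intro exI[of _ \<psi>] exI[of _ "\<lambda>x. fst (Dc (x, T x))"] conjI allI impI)
    show "AE x in lebesgue_on \<Omega>\<^sub>0. GDERIV \<psi> x :> fst (Dc (x, T x)) \<and> fst (Dc (x, T x)) = fst (Dc (x, T x))"
      using grad by simp
  next
    fix \<Phi> :: "space \<Rightarrow> real" and D\<Phi> :: "space \<Rightarrow> space"
    assume tang: "tangential \<Omega>\<^sub>0' f Df D\<Phi>"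
      and refr: "AE x in lebesgue_on \<Omega>\<^sub>0. refracts n\<^sub>1 n\<^sub>2 \<beta> f Df D\<Phi> (e x) (\<phi> x) (T x)"
    show "AE x in lebesgue_on \<Omega>\<^sub>0. fst (D\<Phi> (\<phi> x, f (\<phi> x))) =
      (mat 1 - (1 / (1 + (norm (Df (\<phi> x)))\<^sup>2)) *\<^sub>R tensor (Df (\<phi> x)) (Df (\<phi> x))) *v
      (n\<^sub>2 *\<^sub>R (matrix_inv (transpose (J x)) *v fst (Dc (x, T x)))
        + (n\<^sub>1 * snd (e x)) *\<^sub>R Df (\<phi> x) + n\<^sub>1 *\<^sub>R fst (e x))"
      using refr interior T_target by eventually_elim (rule phase_formula[OF tang])
  qed (fact concave superdiff)+
qed

end
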